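(* Let $k\ge2$ be an integer and $\varepsilon>0$ a constant. Consider the random graph process $\{G_i\}_{i=0}^{\binom{n}{2}}$ on $n$ vertices and let $\tau_k=\min\{m : \delta(G_m)\ge k\}$ denote the step in which the last vertex of degree at most $k-1$ disappears. Then with high probability (as $n\to\infty$, with $k$ and $\varepsilon$ fixed) $G_{\tau_k}$ is $(1/2-\varepsilon,k)$-resilient with respect to $k$-connectivity.
   Context: Random graph process: $G_0$ is the empty graph on $n$ vertices; for each $i\in\{1,\dots,\binom n2\}$, $G_i$ is obtained from $G_{i-1}$ by adding an edge $e\notin E(G_{i-1})$ chosen uniformly at random among the missing edges. With high probability: with probability tending to $1$ as $n\to\infty$. $\delta(G)$ denotes the minimum degree of $G$. A graph is $k$-connected if the removal of at most $k-1$ vertices does not disconnect it. $(\alpha,k)$-resilience: Let $G=(V,E)$ be a graph, $\mathcal P$ a monotone increasing graph property, $\alpha$ a real constant, and $k\ge1$ an integer. $G$ is $(\alpha,k)$-resilient with respect to $\mathcal P$ if for every spanning subgraph $H\subseteq G$ such that $\deg_H(v)\le\alpha\deg_G(v)$ and $\deg_{G-H}(v)\ge k$ for all $v\in V$, we have $G-H\in\mathcal P$, where $G-H$ is the graph on $V$ with edge set $E(G)\setminus E(H)$. *)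

theory Defs
  imports "HOL-Probability.Probability"
begin

text \<open>A finite simple graph is a pair \<open>(V, E)\<close>, an edge being a two-element set of vertices.\<close>

type_synonym 'a ugraph = "'a set \<times> 'a set set"

abbreviation verts :: "'a ugraph \<Rightarrow> 'a set" where "verts G \<equiv> fst G"
abbreviation edges :: "'a ugraph \<Rightarrow> 'a set set" where "edges G \<equiv> snd G"

definition all_edges :: "'a set \<Rightarrow> 'a set set" where
  "all_edges V = {e. e \<subseteq> V \<and> card e = 2}"

definition simple_graph :: "'a ugraph \<Rightarrow> bool" where
  "simple_graph G \<longleftrightarrow> finite (verts G) \<and> edges G \<subseteq> all_edges (verts G)"

definition deg :: "'a ugraph \<Rightarrow> 'a \<Rightarrow> nat" where
  "deg G v = card {e \<in> edges G. v \<in> e}"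

definition min_degree :: "'a ugraph \<Rightarrow> nat" where
  "min_degree G = Min (deg G ` verts G)"

definition spanning_subgraph :: "'a ugraph \<Rightarrow> 'a ugraph \<Rightarrow> bool" where
  "spanning_subgraph H G \<longleftrightarrow> verts H = verts G \<and> edges H \<subseteq> edges G"

definition remove_edges_of :: "'a ugraph \<Rightarrow> 'a ugraph \<Rightarrow> 'a ugraph" where
  "remove_edges_of G H = (verts G, edges G - edges H)"

definition remove_vertices :: "'a ugraph \<Rightarrow> 'a set \<Rightarrow> 'a ugraph" where
  "remove_vertices G S = (verts G - S, {e \<in> edges G. e \<inter> S = {}})"

definition connected_graph :: "'a ugraph \<Rightarrow> bool" where
  "connected_graph G \<longleftrightarrow>
     (\<forall>u\<in>verts G. \<forall>v\<in>verts G. (u, v) \<in> {(x, y). {x, y} \<in> edges G}\<^sup>*)"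

text \<open>No lower bound on the number of vertices is imposed, so a graph on at most \<open>k\<close> vertices
  may be \<open>k\<close>-connected.\<close>

definition k_connected :: "nat \<Rightarrow> 'a ugraph \<Rightarrow> bool" where
  "k_connected k G \<longleftrightarrow>
     (\<forall>S \<subseteq> verts G. finite S \<and> card S < k \<longrightarrow> connected_graph (remove_vertices G S))"

definition monotone_increasing :: "('a ugraph \<Rightarrow> bool) \<Rightarrow> bool" where
  "monotone_increasing P \<longleftrightarrow>
     (\<forall>G G'. simple_graph G \<and> simple_graph G' \<and> spanning_subgraph G G' \<and> P G \<longrightarrow> P G')"

text \<open>Intended for \<open>simple_graph G\<close> and \<open>monotone_increasing P\<close>; the property used below,
  \<open>k_connected k\<close>, is shown to be monotone.\<close>

definition resilient :: "real \<Rightarrow> nat \<Rightarrow> ('a ugraph \<Rightarrow> bool) \<Rightarrow> 'a ugraph \<Rightarrow> bool" where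
  "resilient \<alpha> k P G \<longleftrightarrow>
     (\<forall>H. spanning_subgraph H G \<and>
          (\<forall>v\<in>verts G. real (deg H v) \<le> \<alpha> * real (deg G v) \<and> k \<le> deg (remove_edges_of G H) v)
          \<longrightarrow> P (remove_edges_of G H))"

lemma monotone_increasing_k_connected: "monotone_increasing (k_connected k)"
proof -
  have "connected_graph (remove_vertices G' S)"
    if sub: "spanning_subgraph G G'" and con: "connected_graph (remove_vertices G S)"
    for G G' :: "'a ugraph" and S
  proof -
    have "{(x, y). {x, y} \<in> edges (remove_vertices G S)}\<^sup>*
        \<subseteq> {(x, y). {x, y} \<in> edges (remove_vertices G' S)}\<^sup>*"
      using sub by (intro rtrancl_mono) (auto simp: spanning_subgraph_def remove_vertices_def)
    moreover have "verts (remove_vertices G' S) = verts (remove_vertices G S)"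
      using sub by (simp add: spanning_subgraph_def remove_vertices_def)
    ultimately show ?thesis using con unfolding connected_graph_def by blast
  qed
  then show ?thesis
    unfolding monotone_increasing_def k_connected_def by (metis spanning_subgraph_def)
qed

definition empty_graph :: "nat \<Rightarrow> nat ugraph" where
  "empty_graph n = ({..<n}, {})"

definition missing_edges :: "'a ugraph \<Rightarrow> 'a set set" where
  "missing_edges G = all_edges (verts G) - edges G"

definition add_edge :: "'a ugraph \<Rightarrow> 'a set \<Rightarrow> 'a ugraph" where
  "add_edge G e = (verts G, insert e (edges G))"

text \<open>The joint law of the trajectory \<open>[G\<^sub>0, \<dots>, G\<^sub>i]\<close> on the vertex set \<open>{..<n}\<close>. It is used
  only for \<open>i \<le> n choose 2\<close>, so that the set of missing edges sampled from is never empty.\<close>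

fun process_upto :: "nat \<Rightarrow> nat \<Rightarrow> nat ugraph list pmf" where
  "process_upto n 0 = return_pmf [empty_graph n]"
| "process_upto n (Suc i) =
     bind_pmf (process_upto n i) (\<lambda>Gs.
       map_pmf (\<lambda>e. Gs @ [add_edge (last Gs) e]) (pmf_of_set (missing_edges (last Gs))))"

definition random_graph_process :: "nat \<Rightarrow> nat ugraph list pmf" where
  "random_graph_process n = process_upto n (n choose 2)"

text \<open>\<open>\<tau>\<^sub>k\<close> of a trajectory. If \<open>n > k\<close> a suitable step exists, since the complete graph has
  minimum degree \<open>n - 1\<close>; otherwise the value is unspecified.\<close>

definition hitting_time :: "nat \<Rightarrow> 'a ugraph list \<Rightarrow> nat" where
  "hitting_time k Gs = (LEAST m. m < length Gs \<and> k \<le> min_degree (Gs ! m))"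

end

theory Submission
  imports Defs "HOL-Real_Asymp.Real_Asymp"
begin

text \<open>Let \<open>m1 \<approx> 3/8 n ln n\<close> and \<open>m2 \<approx> n ln n\<close>. With high probability \<open>m1 \<le> \<tau>\<^sub>k \<le> m2\<close>: at time \<open>m1\<close> there
  is an isolated vertex (second moment), at time \<open>m2\<close> there is no vertex of degree below \<open>k\<close>. Call a
  vertex small if its degree is at most \<open>ln n / 100\<close>. First moment computations show that no two
  vertices which are small at time \<open>m1\<close> are adjacent or have a common neighbour at time \<open>m2\<close>, that
  small vertex sets span few edges at time \<open>m2\<close>, and that at all times between \<open>m1\<close> and \<open>m2\<close> every
  linear-sized \<open>A\<close> with \<open>|A| \<le> n/2\<close> satisfies \<open>2 e(A) \<le> (1 + \<epsilon>) e(A, V - A)\<close>. All tail bounds come from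
  one exponential supermartingale along the process.

  Suppose that deleting \<open>S\<close> with \<open>|S| < k\<close> disconnects \<open>G - H\<close>, and let \<open>A\<close> be the smaller side. If \<open>A\<close>
  is small, then it contains non-small vertices, each of which keeps half of its edges, almost all
  of them inside \<open>A \<union> S\<close>, so that the non-small vertices of \<open>A\<close> and \<open>S\<close> span too many edges. If \<open>A\<close>
  is large, then \<open>H\<close> contains all but \<open>O(n)\<close> of the edges leaving \<open>A\<close>, which is more than
  \<open>(1/2 - \<epsilon>) (2 e(A) + e(A, V - A))\<close>, the bound given by the degrees of \<open>H\<close>.\<close>

section \<open>Expectations along the random graph process\<close>

lemma finite_all_edges: "finite V \<Longrightarrow> finite (all_edges V)"
  by (rule finite_subset[of _ "Pow V"]) (auto simp: all_edges_def)

lemma card_all_edges: "finite V \<Longrightarrow> card (all_edges V) = card V choose 2"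
  unfolding all_edges_def by (rule n_subsets)

text \<open>The deterministic facts shared by all runs of positive probability; events and
  expectations are compared on such lists only. Since exactly \<open>j\<close> edges are present at
  step \<open>j\<close>, the number of missing edges is not random, which makes one-step averages
  explicit.\<close>

definition trajectory :: "nat \<Rightarrow> nat \<Rightarrow> nat ugraph list \<Rightarrow> bool" where
  "trajectory n i Gs \<longleftrightarrow> length Gs = Suc i \<and>
     (\<forall>j\<le>i. verts (Gs ! j) = {..<n} \<and> edges (Gs ! j) \<subseteq> all_edges {..<n} \<and> card (edges (Gs ! j)) = j) \<and>
     (\<forall>j j'. j \<le> j' \<and> j' \<le> i \<longrightarrow> edges (Gs ! j) \<subseteq> edges (Gs ! j'))"

lemma trajectory_last: "trajectory n i Gs \<Longrightarrow> last Gs = Gs ! i"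
  by (cases Gs rule: rev_cases) (auto simp: trajectory_def nth_append)

lemma trajectory_missing_edges:
  assumes "trajectory n i Gs"
  shows "missing_edges (last Gs) = all_edges {..<n} - edges (Gs ! i)"
    and "finite (missing_edges (last Gs))"
    and "i \<le> n choose 2" and "card (missing_edges (last Gs)) = (n choose 2) - i"
proof -
  show eq: "missing_edges (last Gs) = all_edges {..<n} - edges (Gs ! i)"
    using assms unfolding missing_edges_def trajectory_last[OF assms] by (simp add: trajectory_def)
  then show "finite (missing_edges (last Gs))"
    by (simp add: finite_all_edges)
  have sub: "edges (Gs ! i) \<subseteq> all_edges {..<n}" and c: "card (edges (Gs ! i)) = i"
    using assms by (auto simp: trajectory_def)
  have fin: "finite (edges (Gs ! i))"
    using sub finite_all_edges finite_lessThan by (metis finite_subset)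
  show "i \<le> n choose 2"
    using card_mono[OF finite_all_edges[OF finite_lessThan] sub] c by (simp add: card_all_edges)
  show "card (missing_edges (last Gs)) = (n choose 2) - i"
    unfolding eq using card_Diff_subset[OF fin sub] c by (simp add: card_all_edges)
qed

lemma trajectory_missing_edges_ne:
  assumes "trajectory n i Gs" "i < n choose 2"
  shows "missing_edges (last Gs) \<noteq> {}"
proof -
  have "card (missing_edges (last Gs)) > 0"
    using trajectory_missing_edges(4)[OF assms(1)] assms(2) by simp
  then show ?thesis by (metis card.empty less_irrefl)
qed

lemma trajectory_snoc:
  assumes t: "trajectory n i Gs" and e: "e \<in> missing_edges (last Gs)"
  shows "trajectory n (Suc i) (Gs @ [add_edge (last Gs) e])"
proof -
  have l: "length Gs = Suc i" using t by (simp add: trajectory_def)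
  have e': "e \<in> all_edges {..<n}" "e \<notin> edges (Gs ! i)"
    using e trajectory_missing_edges(1)[OF t] by auto
  have sub: "edges (Gs ! i) \<subseteq> all_edges {..<n}" and c: "card (edges (Gs ! i)) = i"
    using t by (auto simp: trajectory_def)
  have fin: "finite (edges (Gs ! i))"
    using sub finite_all_edges finite_lessThan by (metis finite_subset)
  have mono: "edges (Gs ! j) \<subseteq> edges (Gs ! i)" if "j \<le> i" for j
    using t that by (auto simp: trajectory_def)
  show ?thesis
    unfolding trajectory_def trajectory_last[OF t]
  proof (intro conjI allI impI)
    show "length (Gs @ [add_edge (Gs ! i) e]) = Suc (Suc i)" using l by simp
    fix j assume j: "j \<le> Suc i"
    show "verts ((Gs @ [add_edge (Gs ! i) e]) ! j) = {..<n}"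
      "edges ((Gs @ [add_edge (Gs ! i) e]) ! j) \<subseteq> all_edges {..<n}"
      "card (edges ((Gs @ [add_edge (Gs ! i) e]) ! j)) = j"
      using t j l e' fin subsetD[OF sub] c
      by (auto simp: trajectory_def nth_append add_edge_def le_Suc_eq)
  next
    fix j j' assume j: "j \<le> j' \<and> j' \<le> Suc i"
    show "edges ((Gs @ [add_edge (Gs ! i) e]) ! j) \<subseteq> edges ((Gs @ [add_edge (Gs ! i) e]) ! j')"
    proof (cases "j' = Suc i")
      case True
      then show ?thesis using j l mono[of j]
        by (cases "j = Suc i") (auto simp: nth_append add_edge_def)
    next
      case False
      then show ?thesis using j l t by (auto simp: nth_append trajectory_def)
    qed
  qed
qed

lemma trajectory_process:
  assumes "i \<le> n choose 2" "Gs \<in> set_pmf (process_upto n i)"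
  shows "trajectory n i Gs"
  using assms
proof (induction i arbitrary: Gs)
  case 0
  then show ?case by (simp add: trajectory_def empty_graph_def)
next
  case (Suc i)
  from Suc.prems(2) obtain Gs' e where Gs': "Gs' \<in> set_pmf (process_upto n i)"
    and e: "e \<in> set_pmf (pmf_of_set (missing_edges (last Gs')))"
    and Gs: "Gs = Gs' @ [add_edge (last Gs') e]" by auto
  have t: "trajectory n i Gs'" using Suc Gs' by simp
  have "e \<in> missing_edges (last Gs')"
    using e trajectory_missing_edges(2)[OF t] trajectory_missing_edges_ne[OF t] Suc.prems(1) by simp
  then show ?case unfolding Gs by (rule trajectory_snoc[OF t])
qed

section \<open>Averaging over the next edge\<close>

lemma finite_set_process: "i \<le> n choose 2 \<Longrightarrow> finite (set_pmf (process_upto n i))"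
proof (induction i)
  case (Suc i)
  have "finite (set_pmf (map_pmf (\<lambda>e. Gs @ [add_edge (last Gs) e]) (pmf_of_set (missing_edges (last Gs)))))"
    if "Gs \<in> set_pmf (process_upto n i)" for Gs
  proof -
    have t: "trajectory n i Gs" using trajectory_process Suc.prems that by simp
    then show ?thesis
      using trajectory_missing_edges(2)[OF t] trajectory_missing_edges_ne[OF t] Suc.prems by simp
  qed
  then show ?case using Suc by auto
qed auto

text \<open>Whatever the history, the next edge is uniform on a set of
  \<open>(n choose 2) - i\<close> missing edges, so the normalising denominator is a constant.
  Finite support turns expectations into finite sums.\<close>

lemma expectation_process_Suc:
  fixes f :: "nat ugraph list \<Rightarrow> real"
  assumes i: "i < n choose 2"
  shows "measure_pmf.expectation (process_upto n (Suc i)) f =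
    measure_pmf.expectation (process_upto n i)
      (\<lambda>Gs. (\<Sum>e\<in>missing_edges (last Gs). f (Gs @ [add_edge (last Gs) e])) / (real (n choose 2) - real i))"
    (is "_ = measure_pmf.expectation _ ?g")
proof -
  define A where "A = set_pmf (process_upto n i)"
  have fA: "finite A" unfolding A_def using finite_set_process i by simp
  let ?h = "\<lambda>Gs. map_pmf (\<lambda>e. Gs @ [add_edge (last Gs) e]) (pmf_of_set (missing_edges (last Gs)))"
  have m: "finite (missing_edges (last Gs))" "missing_edges (last Gs) \<noteq> {}"
     "real (card (missing_edges (last Gs))) = real (n choose 2) - real i" if "Gs \<in> A" for Gs
  proof -
    have t: "trajectory n i Gs" using trajectory_process i that unfolding A_def by simp
    show "finite (missing_edges (last Gs))" "missing_edges (last Gs) \<noteq> {}"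
      "real (card (missing_edges (last Gs))) = real (n choose 2) - real i"
      using trajectory_missing_edges[OF t] trajectory_missing_edges_ne[OF t i] i by (auto simp: of_nat_diff)
  qed
  have "measure_pmf.expectation (process_upto n (Suc i)) f
     = (\<Sum>Gs\<in>A. pmf (process_upto n i) Gs *\<^sub>R measure_pmf.expectation (?h Gs) f)"
    unfolding process_upto.simps
    by (rule pmf_expectation_bind[OF fA]) (use m in \<open>auto simp: A_def\<close>)
  also have "\<dots> = (\<Sum>Gs\<in>A. pmf (process_upto n i) Gs *\<^sub>R ?g Gs)"
    using m by (intro sum.cong refl) (simp add: integral_pmf_of_set)
  also have "\<dots> = measure_pmf.expectation (process_upto n i) ?g"
    by (rule integral_measure_pmf[symmetric]) (auto simp: fA, auto simp: A_def)
  finally show ?thesis .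
qed

lemma expectation_process_mono:
  fixes f g :: "nat ugraph list \<Rightarrow> real"
  assumes "i \<le> n choose 2" "\<And>Gs. trajectory n i Gs \<Longrightarrow> f Gs \<le> g Gs"
  shows "measure_pmf.expectation (process_upto n i) f \<le> measure_pmf.expectation (process_upto n i) g"
  using assms trajectory_process
  by (intro integral_mono_AE integrable_measure_pmf_finite finite_set_process) (auto simp: AE_measure_pmf_iff)

lemma expectation_process_cong:
  fixes f g :: "nat ugraph list \<Rightarrow> real"
  assumes "i \<le> n choose 2" "\<And>Gs. trajectory n i Gs \<Longrightarrow> f Gs = g Gs"
  shows "measure_pmf.expectation (process_upto n i) f = measure_pmf.expectation (process_upto n i) g"
  using assms trajectory_process by (intro integral_cong_AE) (auto simp: AE_measure_pmf_iff)

text \<open>One step of a supermartingale argument with growth factor \<open>r\<close>. The drift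
  condition is multiplied out, so that only a sum over missing edges has to be estimated.\<close>

lemma expectation_process_Suc_le:
  fixes f g :: "nat ugraph list \<Rightarrow> real"
  assumes i: "i < n choose 2"
    and step: "\<And>Gs. trajectory n i Gs \<Longrightarrow>
       (\<Sum>e\<in>missing_edges (last Gs). f (Gs @ [add_edge (last Gs) e])) \<le> r * (real (n choose 2) - real i) * g Gs"
  shows "measure_pmf.expectation (process_upto n (Suc i)) f \<le> r * measure_pmf.expectation (process_upto n i) g"
proof -
  have "measure_pmf.expectation (process_upto n (Suc i)) f
     \<le> measure_pmf.expectation (process_upto n i) (\<lambda>Gs. r * g Gs)"
    unfolding expectation_process_Suc[OF i]
  proof (rule expectation_process_mono)
    fix Gs assume "trajectory n i Gs"
    from step[OF this] show "(\<Sum>e\<in>missing_edges (last Gs). f (Gs @ [add_edge (last Gs) e])) / (real (n choose 2) - real i)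
        \<le> r * g Gs"
      using i by (simp add: divide_le_eq mult_ac)
  qed (use i in simp)
  then show ?thesis by simp
qed

text \<open>Later steps only append a graph and leave the earlier entries alone, so cutting them off
  recovers the law of the shorter run.\<close>

lemma take_process:
  assumes "j \<le> i" "i \<le> n choose 2"
  shows "map_pmf (take (Suc j)) (process_upto n i) = process_upto n j"
  using assms
proof (induction i)
  case 0
  then show ?case by simp
next
  case (Suc i)
  show ?case
  proof (cases "j = Suc i")
    case True
    have "map_pmf (take (Suc j)) (process_upto n (Suc i)) = map_pmf id (process_upto n (Suc i))"
      using True trajectory_process[OF Suc.prems(2)]
      by (intro map_pmf_cong refl) (auto simp: trajectory_def)
    then show ?thesis using True by (simp add: pmf.map_id)
  next
    case False
    then have j: "j \<le> i" using Suc.prems by simp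
    have "map_pmf (take (Suc j)) (process_upto n (Suc i))
       = bind_pmf (process_upto n i) (\<lambda>Gs. map_pmf (take (Suc j))
            (map_pmf (\<lambda>e. Gs @ [add_edge (last Gs) e]) (pmf_of_set (missing_edges (last Gs)))))"
      by (simp add: map_bind_pmf)
    also have "\<dots> = bind_pmf (process_upto n i) (\<lambda>Gs. return_pmf (take (Suc j) Gs))"
    proof (rule bind_pmf_cong[OF refl])
      fix Gs assume "Gs \<in> set_pmf (process_upto n i)"
      then have "length Gs = Suc i"
        using trajectory_process[of i n Gs] Suc.prems by (simp add: trajectory_def)
      then show "map_pmf (take (Suc j)) (map_pmf (\<lambda>e. Gs @ [add_edge (last Gs) e]) (pmf_of_set (missing_edges (last Gs))))
         = return_pmf (take (Suc j) Gs)"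
        using j by (simp add: pmf.map_comp o_def map_pmf_const)
    qed
    also have "\<dots> = process_upto n j"
      using Suc j by (simp flip: map_pmf_def)
    finally show ?thesis .
  qed
qed

text \<open>Moves an event that looks only at times up to \<open>i\<close> to the process run for
  \<open>i\<close> steps. \<open>Q\<close> is the event as written on full runs, \<open>P\<close>
  its form on truncated ones.\<close>

lemma prob_random_graph_process:
  assumes "i \<le> n choose 2" and "\<And>Gs. trajectory n (n choose 2) Gs \<Longrightarrow> Q Gs \<longleftrightarrow> P (take (Suc i) Gs)"
  shows "measure_pmf.prob (random_graph_process n) {Gs. Q Gs} = measure_pmf.prob (process_upto n i) {Gs. P Gs}"
proof -
  have "measure_pmf.prob (process_upto n i) {Gs. P Gs} =
    measure_pmf.prob (process_upto n (n choose 2)) {Gs. P (take (Suc i) Gs)}"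
    using take_process[OF assms(1) order_refl] measure_map_pmf[of "take (Suc i)" "process_upto n (n choose 2)" "{Gs. P Gs}"]
    by (simp add: vimage_def)
  also have "\<dots> = measure_pmf.prob (random_graph_process n) {Gs. Q Gs}"
    unfolding random_graph_process_def
    by (rule measure_prob_cong_0) (use assms(2) trajectory_process in \<open>auto simp: set_pmf_iff\<close>)
  finally show ?thesis by simp
qed

section \<open>Tail bounds\<close>

lemma card_insert_Int:
  "finite E \<Longrightarrow> e \<notin> E \<Longrightarrow> card (insert e E \<inter> D) = card (E \<inter> D) + of_bool (e \<in> D)"
  by (auto simp: Int_insert_left)

text \<open>As \<open>D\<close> and \<open>F\<close> are disjoint, at most one of the two factors
  differs from 1, so each weight is linear in the two indicators. By
  \<open>D - E \<subseteq> M\<close>, at least \<open>card D - s\<close> edges of \<open>D\<close>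
  can still be drawn.\<close>

lemma sum_tilt_le:
  fixes x L s N :: real
  assumes fin: "finite D" "finite F" "finite M" and disj: "D \<inter> F = {}" and MD: "D - E \<subseteq> M"
    and x: "0 < x" "x \<le> 1" and L: "1 \<le> L" and c: "card (E \<inter> D) \<le> s"
    and M: "real (card M) = N"
  shows "(\<Sum>e\<in>M. x ^ of_bool (e \<in> D) * L ^ of_bool (e \<in> F)) \<le> N - (1 - x) * (card D - s) + (L - 1) * card F"
proof -
  have "(\<Sum>e\<in>M. x ^ of_bool (e \<in> D) * L ^ of_bool (e \<in> F))
      = (\<Sum>e\<in>M. 1 - (1 - x) * of_bool (e \<in> D) + (L - 1) * of_bool (e \<in> F))"
    using disj by (intro sum.cong refl) (auto simp: of_bool_def)
  also have "\<dots> = N - (1 - x) * card (M \<inter> D) + (L - 1) * card (M \<inter> F)"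
    using fin by (simp add: sum.distrib sum_subtractf M flip: sum_distrib_left)
  also have "\<dots> \<le> N - (1 - x) * (card D - s) + (L - 1) * card F"
  proof -
    have "card D = card (E \<inter> D) + card (D - E)"
      using fin by (metis Int_commute card_Int_Diff)
    moreover have "card (D - E) \<le> card (M \<inter> D)"
      using MD fin by (intro card_mono) auto
    ultimately have "card D - s \<le> real (card (M \<inter> D))" using c by linarith
    moreover have "real (card (M \<inter> F)) \<le> card F"
      using fin by (auto intro: card_mono)
    ultimately show ?thesis using x L
      by (intro add_mono diff_mono mult_left_mono) auto
  qed
  finally show ?thesis .
qed

text \<open>As long as at most \<open>s\<close> edges of \<open>D\<close> are present, each step multiplies the expectation of
  \<open>x ^ card (E \<inter> D) * L ^ card (E \<inter> F)\<close> by at most the factor estimated in \<open>sum_tilt_le\<close>; stopping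
  the first factor at time \<open>m1\<close> gives a joint bound for two different times.\<close>

lemma process_joint_tail:
  fixes x L s r :: real and n :: nat
  defines "N \<equiv> real (n choose 2)"
  assumes m: "m1 \<le> m2" "m2 < n choose 2" and D: "D \<subseteq> all_edges {..<n}" and F: "F \<subseteq> all_edges {..<n}"
    and disj: "D \<inter> F = {}" and x: "0 < x" "x \<le> 1" and L: "1 \<le> L" and s: "s \<le> card D"
  shows "measure_pmf.prob (random_graph_process n)
     {Gs. card (edges (Gs ! m1) \<inter> D) \<le> s \<and> r \<le> card (edges (Gs ! m2) \<inter> F)}
     \<le> x powr (- s) * L powr (- r) * exp (- (1 - x) * m1 * (card D - s) / N + (L - 1) * card F * m2 / (N - m2))"
proof -
  have fin: "finite D" "finite F" using D F finite_all_edges finite_lessThan by (metis finite_subset)+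
  \<comment> \<open>Per-step decay and growth rates: the number of missing edges is always at most
    \<open>N\<close>, and at least \<open>N - m2\<close> up to time \<open>m2\<close>.\<close>
  define a where "a = (1 - x) * (card D - s) / N"
  define b where "b = (L - 1) * card F / (N - m2)"
  have "N - m2 > 0" using m by (simp add: N_def)
  then have N: "N > 0" "N - m2 > 0" by linarith+
  have a: "a \<ge> 0" and b: "b \<ge> 0" using x s L N by (auto simp: a_def b_def)
  \<comment> \<open>The weight is cut to 0 once \<open>D\<close> has received more than
    \<open>s\<close> edges. Edge counts never decrease, so a cut run stays cut; on the other runs at
    least \<open>card D - s\<close> edges of \<open>D\<close> are missing, as the drift estimate
    requires.\<close>
  define W where "W i Gs = (if card (edges (Gs ! min i m1) \<inter> D) \<le> s
     then x ^ card (edges (Gs ! min i m1) \<inter> D) * L ^ card (edges (Gs ! i) \<inter> F) else 0)" for i and Gs :: "nat ugraph list"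
  have step: "measure_pmf.expectation (process_upto n (Suc i)) (W (Suc i))
      \<le> exp (b - (if i < m1 then a else 0)) * measure_pmf.expectation (process_upto n i) (W i)" if i: "i < m2" for i
  proof (rule expectation_process_Suc_le)
    show iN: "i < n choose 2" using i m by simp
    fix Gs assume t: "trajectory n i Gs"
    define E where "E = edges (Gs ! i)"
    define M where "M = missing_edges (last Gs)"
    have M: "finite M" "real (card M) = N - i" "M = all_edges {..<n} - E"
      using trajectory_missing_edges[OF t] iN by (auto simp: M_def N_def E_def of_nat_diff)
    have finE: "finite E" using t finite_all_edges[OF finite_lessThan] unfolding E_def trajectory_def
      by (metis finite_subset order_refl)
    have len: "length Gs = Suc i" using t by (simp add: trajectory_def)
    have add_edges: "edges (add_edge (last Gs) e) = insert e E" for e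
      by (simp add: add_edge_def trajectory_last[OF t] E_def)
    have Suc_edges: "edges ((Gs @ [add_edge (last Gs) e]) ! Suc i) = insert e E" for e
      using len by (simp add: nth_append add_edge_def trajectory_last[OF t] E_def)
    have F_card: "card (insert e E \<inter> F) = card (E \<inter> F) + of_bool (e \<in> F)" if "e \<in> M" for e
      using that M finE by (intro card_insert_Int) auto
    have D_card: "card (insert e E \<inter> D) = card (E \<inter> D) + of_bool (e \<in> D)" if "e \<in> M" for e
      using that M finE by (intro card_insert_Int) auto
    define w where "w = W i Gs"
    have w0: "w \<ge> 0" using x L by (simp add: w_def W_def)
    have Nb: "(L - 1) * card F \<le> b * (N - i)"
    proof -
      have "(L - 1) * card F = b * (N - m2)" using N by (simp add: b_def)
      also have "\<dots> \<le> b * (N - i)" using b i by (intro mult_left_mono) auto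
      finally show ?thesis .
    qed
    have Na: "a * (N - i) \<le> (1 - x) * (card D - s)"
    proof -
      have "a * (N - i) \<le> a * N" using a by (intro mult_left_mono) auto
      also have "\<dots> = (1 - x) * (card D - s)" using N by (simp add: a_def)
      finally show ?thesis .
    qed
    have "(\<Sum>e\<in>M. W (Suc i) (Gs @ [add_edge (last Gs) e])) \<le> (1 + (b - (if i < m1 then a else 0))) * (N - i) * w"
    proof (cases "i < m1")
      case True
      have le: "W (Suc i) (Gs @ [add_edge (last Gs) e]) \<le> w * (x ^ of_bool (e \<in> D) * L ^ of_bool (e \<in> F))"
        if "e \<in> M" for e
        using True x L unfolding w_def W_def
        by (simp add: min_absorb1 Suc_edges F_card[OF that] D_card[OF that] power_add flip: E_def)
      have "(\<Sum>e\<in>M. W (Suc i) (Gs @ [add_edge (last Gs) e]))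
           \<le> w * (\<Sum>e\<in>M. x ^ of_bool (e \<in> D) * L ^ of_bool (e \<in> F))"
        unfolding sum_distrib_left by (intro sum_mono le)
      also have "\<dots> \<le> w * (N - i - (1 - x) * (card D - s) + (L - 1) * card F)"
      proof (cases "card (E \<inter> D) \<le> s")
        case c: True
        show ?thesis
          by (rule mult_left_mono[OF sum_tilt_le[OF fin M(1) disj _ x L c M(2)] w0]) (use D M in auto)
      next
        case False
        then show ?thesis using True by (simp add: w_def W_def E_def)
      qed
      also have "\<dots> \<le> w * ((1 + (b - a)) * (N - i))"
        using Na Nb by (intro mult_left_mono w0) (simp add: algebra_simps)
      finally show ?thesis using True by (simp add: mult_ac)
    next
      case False
      then have m1i: "m1 \<le> i" by simp
      \<comment> \<open>The factor for \<open>D\<close> is frozen from \<open>m1\<close> on, so the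
        one-step estimate is reused with the empty set in place of \<open>D\<close>.\<close>
      have le: "W (Suc i) (Gs @ [add_edge (last Gs) e]) = w * (x ^ of_bool (e \<in> {}) * L ^ of_bool (e \<in> F))"
        if "e \<in> M" for e
        using m1i len unfolding w_def W_def
        by (simp add: add_edges F_card[OF that] nth_append power_add min_def flip: E_def)
      have "(\<Sum>e\<in>M. W (Suc i) (Gs @ [add_edge (last Gs) e]))
           = w * (\<Sum>e\<in>M. x ^ of_bool (e \<in> {}) * L ^ of_bool (e \<in> F))"
        unfolding sum_distrib_left by (intro sum.cong refl le)
      also have "\<dots> \<le> w * (N - i - (1 - x) * (real (card ({} :: nat set set)) - 0) + (L - 1) * card F)"
        by (rule mult_left_mono[OF sum_tilt_le[where E = "{}", OF _ fin(2) M(1) _ _ x L _ M(2)] w0]) auto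
      also have "\<dots> \<le> w * ((1 + b) * (N - i))"
        using Nb by (intro mult_left_mono w0) (simp add: algebra_simps)
      finally show ?thesis using False by (simp add: mult_ac)
    qed
    also have "\<dots> \<le> exp (b - (if i < m1 then a else 0)) * (N - i) * w"
      using i m w0 by (intro mult_right_mono exp_ge_add_one_self) (auto simp: N_def)
    finally show "(\<Sum>e\<in>missing_edges (last Gs). W (Suc i) (Gs @ [add_edge (last Gs) e]))
       \<le> exp (b - (if i < m1 then a else 0)) * (real (n choose 2) - real i) * W i Gs"
      by (simp add: M_def N_def w_def)
  qed
  have W: "measure_pmf.expectation (process_upto n i) (W i) \<le> exp (b * i - a * min i m1)" if "i \<le> m2" for i
    using that
  proof (induction i)
    case 0
    then show ?case by (simp add: W_def empty_graph_def)
  next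
    case (Suc i)
    have "measure_pmf.expectation (process_upto n (Suc i)) (W (Suc i))
      \<le> exp (b - (if i < m1 then a else 0)) * measure_pmf.expectation (process_upto n i) (W i)"
      by (rule step) (use Suc in simp)
    also have "\<dots> \<le> exp (b - (if i < m1 then a else 0)) * exp (b * i - a * min i m1)"
      using Suc by (intro mult_left_mono) auto
    also have "\<dots> = exp (b * Suc i - a * min (Suc i) m1)"
      by (auto simp: algebra_simps min_def simp flip: exp_add)
    finally show ?case .
  qed
  define P where "P Gs \<longleftrightarrow> card (edges (Gs ! m1) \<inter> D) \<le> s \<and> r \<le> card (edges (Gs ! m2) \<inter> F)"
    for Gs :: "nat ugraph list"
  have "measure_pmf.prob (random_graph_process n) {Gs. P Gs} = measure_pmf.prob (process_upto n m2) {Gs. P Gs}"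
    by (rule prob_random_graph_process) (use m in \<open>auto simp: P_def\<close>)
  also have "\<dots> = measure_pmf.expectation (process_upto n m2) (indicator {Gs. P Gs})"
    by simp
  \<comment> \<open>Markov's inequality: on the event \<open>P\<close> the normalised weight is at
    least 1, because \<open>x \<le> 1\<close> and \<open>1 \<le> L\<close>.\<close>
  also have "\<dots> \<le> measure_pmf.expectation (process_upto n m2) (\<lambda>Gs. x powr (- s) * L powr (- r) * W m2 Gs)"
  proof (rule expectation_process_mono)
    fix Gs assume "trajectory n m2 Gs"
    show "indicator {Gs. P Gs} Gs \<le> x powr (- s) * L powr (- r) * W m2 Gs"
    proof (cases "P Gs")
      case True
      let ?c = "card (edges (Gs ! m1) \<inter> D)" and ?f = "card (edges (Gs ! m2) \<inter> F)"
      have "1 \<le> x powr (?c - s)"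
        using True x powr_mono'[of "?c - s" 0 x] by (simp add: P_def)
      moreover have "1 \<le> L powr (?f - r)"
        using True L by (simp add: P_def ge_one_powr_ge_zero)
      ultimately have "1 * 1 \<le> x powr (?c - s) * L powr (?f - r)"
        by (intro mult_mono) auto
      also have "\<dots> = x powr (- s) * L powr (- r) * (x ^ ?c * L ^ ?f)"
        using x L by (simp add: powr_diff powr_minus divide_inverse powr_realpow)
      also have "\<dots> = x powr (- s) * L powr (- r) * W m2 Gs"
        using True m by (simp add: W_def P_def min_absorb2)
      finally show ?thesis using True by simp
    next
      case False
      then show ?thesis using x L by (simp add: W_def)
    qed
  qed (use m in simp)
  also have "\<dots> = x powr (- s) * L powr (- r) * measure_pmf.expectation (process_upto n m2) (W m2)"
    by simp
  also have "\<dots> \<le> x powr (- s) * L powr (- r) * exp (b * m2 - a * min m2 m1)"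
    by (intro mult_left_mono W) auto
  also have "b * m2 - a * min m2 m1 = - (1 - x) * m1 * (card D - s) / N + (L - 1) * card F * m2 / (N - m2)"
    using m by (simp add: a_def b_def min_absorb2 algebra_simps flip: add_divide_distrib)
  finally show ?thesis by (simp add: P_def)
qed

corollary process_lower_tail:
  fixes x s :: real and n :: nat
  assumes "m < n choose 2" "D \<subseteq> all_edges {..<n}" "0 < x" "x \<le> 1" "s \<le> card D"
  shows "measure_pmf.prob (random_graph_process n) {Gs. card (edges (Gs ! m) \<inter> D) \<le> s}
     \<le> x powr (- s) * exp (- (1 - x) * m * (card D - s) / real (n choose 2))"
  using process_joint_tail[of m m n D "{}" x 1 s 0] assms by simp

corollary process_upper_tail:
  fixes L r :: real and n :: nat
  assumes "m < n choose 2" "F \<subseteq> all_edges {..<n}" "1 \<le> L"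
  shows "measure_pmf.prob (random_graph_process n) {Gs. r \<le> card (edges (Gs ! m) \<inter> F)}
     \<le> L powr (- r) * exp ((L - 1) * card F * m / (real (n choose 2) - m))"
  using process_joint_tail[of m m n "{}" F 1 L 0 r] assms by simp

text \<open>As long as \<open>D\<close> has been avoided, all its edges are among the
  \<open>(n choose 2) - j\<close> missing ones, which fixes the conditional probability of avoiding
  it once more. An exact value serves the second moment argument, which divides by single-vertex
  probabilities and bounds pair probabilities from above.\<close>

lemma prob_avoid:
  fixes n :: nat
  assumes i: "i \<le> n choose 2" and D: "D \<subseteq> all_edges {..<n}"
  shows "measure_pmf.prob (process_upto n i) {Gs. edges (Gs ! i) \<inter> D = {}}
     = (\<Prod>j<i. 1 - card D / (real (n choose 2) - real j))"
  using i
proof (induction i)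
  case 0
  then show ?case by (simp add: empty_graph_def)
next
  case (Suc i)
  let ?A = "\<lambda>i. {Gs :: nat ugraph list. edges (Gs ! i) \<inter> D = {}}"
  have i: "i < n choose 2" using Suc.prems by simp
  have finD: "finite D" using D finite_all_edges finite_lessThan by (metis finite_subset)
  have "measure_pmf.prob (process_upto n (Suc i)) (?A (Suc i))
     = measure_pmf.expectation (process_upto n (Suc i)) (indicator (?A (Suc i)))"
    by simp
  also have "\<dots> = measure_pmf.expectation (process_upto n i)
      (\<lambda>Gs. (1 - card D / (real (n choose 2) - i)) * indicator (?A i) Gs)"
    unfolding expectation_process_Suc[OF i]
  proof (rule expectation_process_cong)
    fix Gs assume t: "trajectory n i Gs"
    define M where "M = missing_edges (last Gs)"
    have M: "finite M" "real (card M) = real (n choose 2) - i" "M = all_edges {..<n} - edges (Gs ! i)"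
      using trajectory_missing_edges[OF t] i by (auto simp: M_def of_nat_diff)
    have len: "length Gs = Suc i" using t by (simp add: trajectory_def)
    have ind: "indicator (?A (Suc i)) (Gs @ [add_edge (last Gs) e]) = (indicator (?A i) Gs * of_bool (e \<notin> D) :: real)" for e
      using len by (auto simp: nth_append add_edge_def trajectory_last[OF t] indicator_def)
    have "(\<Sum>e\<in>M. indicator (?A (Suc i)) (Gs @ [add_edge (last Gs) e]))
       = (indicator (?A i) Gs * real (card {e \<in> M. e \<notin> D}) :: real)"
      unfolding ind using M(1) by (simp add: Int_def flip: sum_distrib_left)
    also have "\<dots> = indicator (?A i) Gs * (real (card M) - card D)"
    proof (cases "Gs \<in> ?A i")
      case True
      then have sub: "D \<subseteq> M" using D M by auto
      have "card {e \<in> M. e \<notin> D} = card M - card D"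
        using card_Diff_subset[OF finD sub] by (simp add: set_diff_eq)
      then show ?thesis using card_mono[OF M(1) sub] by (simp add: of_nat_diff)
    qed auto
    finally show "(\<Sum>e\<in>missing_edges (last Gs). indicator (?A (Suc i)) (Gs @ [add_edge (last Gs) e])) /
         (real (n choose 2) - real i) = (1 - card D / (real (n choose 2) - i)) * indicator (?A i) Gs"
      using i unfolding M(2) by (simp add: M_def field_simps)
  qed (use i in simp)
  also have "\<dots> = (1 - card D / (real (n choose 2) - i)) * measure_pmf.prob (process_upto n i) (?A i)"
    by simp
  finally show ?case using Suc by simp
qed

section \<open>Isolated vertices\<close>

definition star :: "nat \<Rightarrow> nat \<Rightarrow> nat set set" where
  "star n v = {e \<in> all_edges {..<n}. v \<in> e}"

lemma star_subset: "star n v \<subseteq> all_edges {..<n}"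
  by (auto simp: star_def)

lemma finite_star: "finite (star n v)"
  using star_subset finite_all_edges finite_lessThan by (metis finite_subset)

lemma card_star:
  assumes "v < n"
  shows "card (star n v) = n - 1"
proof -
  have "star n v = (\<lambda>u. {v, u}) ` ({..<n} - {v})"
  proof
    show "star n v \<subseteq> (\<lambda>u. {v, u}) ` ({..<n} - {v})"
    proof
      fix e assume "e \<in> star n v"
      then have e: "e \<subseteq> {..<n}" "card e = 2" "v \<in> e" by (auto simp: star_def all_edges_def)
      then obtain u where "e = {v, u}" "u \<noteq> v" by (auto simp: card_2_iff)
      then show "e \<in> (\<lambda>u. {v, u}) ` ({..<n} - {v})" using e by auto
    qed
    show "(\<lambda>u. {v, u}) ` ({..<n} - {v}) \<subseteq> star n v"
      using assms by (auto simp: star_def all_edges_def)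
  qed
  moreover have "inj_on (\<lambda>u. {v, u}) ({..<n} - {v})"
    by (auto simp: inj_on_def doubleton_eq_iff)
  ultimately show ?thesis using assms by (simp add: card_image)
qed

lemma star_Int_star:
  assumes "u < n" "v < n" "u \<noteq> v"
  shows "star n u \<inter> star n v = {{u, v}}"
  using assms by (auto simp: star_def all_edges_def card_2_iff)

lemma card_star_Un:
  assumes "u < n" "v < n" "u \<noteq> v"
  shows "real (card (star n u \<union> star n v)) = 2 * real n - 3"
proof -
  have "card (star n u) + card (star n v) = card (star n u \<union> star n v) + card (star n u \<inter> star n v)"
    by (rule card_Un_Int) (rule finite_star)+
  then have "n - 1 + (n - 1) = card (star n u \<union> star n v) + 1"
    using assms by (simp add: star_Int_star card_star)
  then show ?thesis using assms by linarith
qed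

text \<open>Puts degrees into the form of edge counts in a fixed set, to which the tail bounds and
  \<open>prob_avoid\<close> apply.\<close>

lemma deg_eq_card_star:
  assumes "edges G \<subseteq> all_edges {..<n}"
  shows "deg G v = card (edges G \<inter> star n v)"
  unfolding deg_def star_def by (rule arg_cong[where f = card]) (use assms in auto)

text \<open>With \<open>M = N - real j\<close>, the factor for a pair is the squared factor for one
  vertex plus \<open>1 / M\<close> minus \<open>((real n - 1) / M)\<^sup>2\<close>; the term
  \<open>1 / M\<close> comes from the one edge shared by the two stars. This excess of at most
  \<open>1 / M\<close> per step is absorbed into the exponential.\<close>

lemma prod_pair_le:
  fixes n :: nat and N :: real
  assumes "2 * n + m < N"
  shows "(\<Prod>j<m. 1 - (2 * real n - 3) / (N - real j))
     \<le> (\<Prod>j<m. 1 - (real n - 1) / (N - real j))\<^sup>2 * exp (m * N / (N - m - n)\<^sup>2)"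
proof -
  have "(\<Prod>j<m. 1 - (2 * real n - 3) / (N - real j))
     \<le> (\<Prod>j<m. (1 - (real n - 1) / (N - real j))\<^sup>2 * exp (N / (N - m - n)\<^sup>2))"
  proof (rule prod_mono, intro conjI)
    fix j assume j: "j \<in> {..<m}"
    define M where "M = N - real j"
    define y where "y = M - (real n - 1)"
    have M: "M > 0" "M \<le> N" and y: "y \<ge> N - m - n" and pos: "N - m - n > 0"
      using assms j by (auto simp: M_def y_def)
    have "2 * real n - 3 \<le> M" using assms j by (simp add: M_def)
    then show "0 \<le> 1 - (2 * real n - 3) / (N - real j)" using M by (simp add: M_def)
    have "1 - (2 * real n - 3) / M \<le> (y / M)\<^sup>2 + 1 / M"
    proof -
      have "(y / M)\<^sup>2 + 1 / M - (1 - (2 * real n - 3) / M) = ((real n - 1) / M)\<^sup>2"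
        using M by (simp add: y_def power2_eq_square field_simps)
      then show ?thesis by (smt (verit) zero_le_power2)
    qed
    also have "\<dots> = (y / M)\<^sup>2 * (1 + M / y\<^sup>2)"
      using M y pos by (simp add: field_simps power2_eq_square)
    also have "\<dots> \<le> (y / M)\<^sup>2 * exp (N / (N - m - n)\<^sup>2)"
    proof (intro mult_left_mono)
      have "M / y\<^sup>2 \<le> N / (N - m - n)\<^sup>2"
        using M y pos by (intro frac_le power_mono) auto
      then show "1 + M / y\<^sup>2 \<le> exp (N / (N - m - n)\<^sup>2)"
        using exp_ge_add_one_self[of "N / (N - m - n)\<^sup>2"] by linarith
    qed auto
    also have "y / M = 1 - (real n - 1) / (N - real j)"
      using M by (simp add: y_def M_def field_simps)
    finally show "1 - (2 * real n - 3) / (N - real j) \<le> (1 - (real n - 1) / (N - real j))\<^sup>2 * exp (N / (N - m - n)\<^sup>2)"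
      by (simp add: M_def)
  qed
  also have "\<dots> = (\<Prod>j<m. 1 - (real n - 1) / (N - real j))\<^sup>2 * exp (m * N / (N - m - n)\<^sup>2)"
    by (simp add: prod.distrib prod_power_distrib exp_of_nat_mult[symmetric])
  finally show ?thesis .
qed

text \<open>Chebyshev's inequality for the number \<open>X\<close> of isolated vertices, where
  \<open>q\<close> is the exact probability that a given vertex is isolated. The diagonal of the
  second moment contributes \<open>1 / (n * q)\<close>, the correlation of distinct vertices the
  other term.\<close>

lemma prob_no_isolated_le:
  fixes n m :: nat and N q :: real
  defines "N \<equiv> real (n choose 2)"
  defines "q \<equiv> (\<Prod>j<m. 1 - (real n - 1) / (N - real j))"
  assumes m: "2 * n + m < n choose 2" and n: "n \<ge> 1"
  shows "measure_pmf.prob (random_graph_process n) {Gs. \<forall>v<n. deg (Gs ! m) v \<noteq> 0}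
    \<le> 1 / (n * q) + (exp (m * N / (N - m - n)\<^sup>2) - 1)"
proof -
  define p where "p = process_upto n m"
  define c where "c = exp (m * N / (N - m - n)\<^sup>2)"
  define A where "A v = {Gs :: nat ugraph list. edges (Gs ! m) \<inter> star n v = {}}" for v
  define X where "X Gs = (\<Sum>v<n. indicator (A v) Gs :: real)" for Gs
  have mN: "m \<le> n choose 2" and mN': "2 * real n + m < N" using m by (auto simp: N_def)
  have fin: "finite (set_pmf p)" unfolding p_def by (rule finite_set_process[OF mN])
  have int: "integrable p f" for f :: "_ \<Rightarrow> real"
    by (rule integrable_measure_pmf_finite[OF fin])
  have q: "q > 0" unfolding q_def
  proof (rule prod_pos)
    fix j assume "j \<in> {..<m}"
    then have "N - real j > real n" using mN' by simp
    then show "0 < 1 - (real n - 1) / (N - real j)" using n by simp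
  qed
  have A1: "measure_pmf.prob p (A v) = q" if "v < n" for v
    using prob_avoid[OF mN star_subset, of v] that n
    by (simp add: p_def A_def q_def N_def card_star of_nat_diff)
  have A2: "measure_pmf.prob p (A u \<inter> A v) \<le> q\<^sup>2 * c" if uv: "u < n" "v < n" "u \<noteq> v" for u v
  proof -
    have "measure_pmf.prob p (A u \<inter> A v) = measure_pmf.prob p {Gs. edges (Gs ! m) \<inter> (star n u \<union> star n v) = {}}"
      by (intro arg_cong2[where f = measure] refl) (auto simp: A_def)
    also have "\<dots> = (\<Prod>j<m. 1 - (2 * real n - 3) / (N - real j))"
      unfolding p_def using prob_avoid[OF mN Un_least[OF star_subset star_subset], of u v]
      by (simp add: card_star_Un[OF uv] N_def)
    also have "\<dots> \<le> q\<^sup>2 * c"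
      unfolding q_def c_def by (rule prod_pair_le) (use mN' in auto)
    finally show ?thesis .
  qed
  have EX: "measure_pmf.expectation p X = n * q"
    unfolding X_def by (subst Bochner_Integration.integral_sum) (simp_all add: int A1)
  have EX2: "measure_pmf.expectation p (\<lambda>Gs. (X Gs)\<^sup>2) \<le> n * q + n * n * (q\<^sup>2 * c)"
  proof -
    have "(X Gs)\<^sup>2 = (\<Sum>u<n. \<Sum>v<n. indicator (A u \<inter> A v) Gs)" for Gs
      by (simp add: X_def power2_eq_square sum_product indicator_inter_arith)
    then have "measure_pmf.expectation p (\<lambda>Gs. (X Gs)\<^sup>2) = (\<Sum>u<n. \<Sum>v<n. measure_pmf.prob p (A u \<inter> A v))"
      by (simp add: Bochner_Integration.integral_sum int)
    also have "\<dots> \<le> (\<Sum>u<n. \<Sum>v<n. of_bool (u = v) * q + q\<^sup>2 * c)"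
    proof (intro sum_mono)
      fix u v assume "u \<in> {..<n}" "v \<in> {..<n}"
      then show "measure_pmf.prob p (A u \<inter> A v) \<le> of_bool (u = v) * q + q\<^sup>2 * c"
        using A1[of u] A2[of u v] by (cases "u = v") (auto simp: c_def)
    qed
    also have "\<dots> = n * q + n * n * (q\<^sup>2 * c)"
      by (simp add: sum.distrib algebra_simps flip: sum_distrib_right)
    finally show ?thesis .
  qed
  have nq: "n * q > 0" using q n by simp
  have "measure_pmf.prob (random_graph_process n) {Gs. \<forall>v<n. deg (Gs ! m) v \<noteq> 0} =
     measure_pmf.prob p {Gs. \<forall>v<n. Gs \<notin> A v}"
    unfolding p_def
  proof (rule prob_random_graph_process[OF mN])
    fix Gs assume t: "trajectory n (n choose 2) Gs"
    then have "edges (Gs ! m) \<subseteq> all_edges {..<n}" using mN by (auto simp: trajectory_def)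
    then show "(\<forall>v<n. deg (Gs ! m) v \<noteq> 0) \<longleftrightarrow> (\<forall>v<n. take (Suc m) Gs \<notin> A v)"
      using finite_star by (simp add: deg_eq_card_star A_def)
  qed
  \<comment> \<open>Without isolated vertices \<open>X\<close> vanishes and so misses its mean
    \<open>n * q\<close> by exactly that amount.\<close>
  also have "\<dots> \<le> measure_pmf.prob p {Gs \<in> space (measure_pmf p). n * q \<le> \<bar>X Gs - measure_pmf.expectation p X\<bar>}"
  proof (rule measure_pmf.finite_measure_mono)
    have "X Gs = 0" if "\<forall>v<n. Gs \<notin> A v" for Gs
      using that by (simp add: X_def)
    then show "{Gs. \<forall>v<n. Gs \<notin> A v} \<subseteq> {Gs \<in> space (measure_pmf p). n * q \<le> \<bar>X Gs - measure_pmf.expectation p X\<bar>}"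
      using nq by (auto simp: EX)
  qed simp
  also have "\<dots> \<le> measure_pmf.variance p X / (n * q)\<^sup>2"
    by (rule measure_pmf.Chebyshev_inequality) (use nq int in auto)
  also have "measure_pmf.variance p X = measure_pmf.expectation p (\<lambda>Gs. (X Gs)\<^sup>2) - (n * q)\<^sup>2"
    by (subst measure_pmf.variance_eq) (simp_all add: int EX)
  also have "\<dots> / (n * q)\<^sup>2 \<le> (n * q + n * n * (q\<^sup>2 * c) - (n * q)\<^sup>2) / (n * q)\<^sup>2"
    using EX2 by (intro divide_right_mono) auto
  also have "\<dots> = 1 / (n * q) + (c - 1)"
    using n q by (simp add: field_simps power2_eq_square)
  finally show ?thesis by (simp add: c_def)
qed

section \<open>Resilience from pseudorandomness\<close>

definition cut :: "'a set \<Rightarrow> 'a set \<Rightarrow> 'a set set" where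
  "cut A B = {e. \<exists>a\<in>A. \<exists>b\<in>B. e = {a, b}}"

text \<open>The witness is the set of vertices reachable from one end of a pair that no path
  joins.\<close>

lemma not_connected_obtain_closed:
  assumes "\<not> connected_graph G"
  obtains C where "C \<subseteq> verts G" "C \<noteq> {}" "verts G - C \<noteq> {}"
    "\<And>a b. a \<in> C \<Longrightarrow> b \<in> verts G - C \<Longrightarrow> {a, b} \<notin> edges G"
proof -
  let ?R = "{(x, y). {x, y} \<in> edges G}\<^sup>*"
  obtain u v where uv: "u \<in> verts G" "v \<in> verts G" "(u, v) \<notin> ?R"
    using assms by (auto simp: connected_graph_def)
  define C where "C = {w \<in> verts G. (u, w) \<in> ?R}"
  show thesis
  proof (rule that)
    show "C \<subseteq> verts G" "C \<noteq> {}" "verts G - C \<noteq> {}" using uv by (auto simp: C_def)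
    fix a b assume a: "a \<in> C" and b: "b \<in> verts G - C"
    show "{a, b} \<notin> edges G"
    proof
      assume "{a, b} \<in> edges G"
      then have "(u, b) \<in> ?R" using a by (auto simp: C_def intro: rtrancl_into_rtrancl)
      then show False using b by (simp add: C_def)
    qed
  qed
qed

lemma finite_edges: "simple_graph G \<Longrightarrow> finite (edges G)"
  unfolding simple_graph_def by (rule finite_subset[of _ "Pow (verts G)"]) (auto simp: all_edges_def)

lemma deg_eq_card_neighbours:
  assumes G: "simple_graph G"
  shows "deg G v = card {w. {v, w} \<in> edges G}"
proof -
  have "bij_betw (\<lambda>w. {v, w}) {w. {v, w} \<in> edges G} {e \<in> edges G. v \<in> e}"
  proof (rule bij_betw_imageI)
    show "inj_on (\<lambda>w. {v, w}) {w. {v, w} \<in> edges G}"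
      by (auto simp: inj_on_def doubleton_eq_iff)
    show "(\<lambda>w. {v, w}) ` {w. {v, w} \<in> edges G} = {e \<in> edges G. v \<in> e}"
    proof
      show "{e \<in> edges G. v \<in> e} \<subseteq> (\<lambda>w. {v, w}) ` {w. {v, w} \<in> edges G}"
      proof
        fix e assume e: "e \<in> {e \<in> edges G. v \<in> e}"
        then have "card e = 2" using G by (auto simp: simple_graph_def all_edges_def)
        then obtain w where "e = {v, w}" using e by (auto simp: card_2_iff)
        then show "e \<in> (\<lambda>w. {v, w}) ` {w. {v, w} \<in> edges G}" using e by auto
      qed
    qed auto
  qed
  then show ?thesis unfolding deg_def by (rule bij_betw_same_card[symmetric])
qed

text \<open>Double counting of incidences: an edge inside \<open>A\<close> meets \<open>A\<close>
  twice, an edge leaving \<open>A\<close> once.\<close>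

lemma sum_deg_eq:
  assumes G: "simple_graph G" and A: "A \<subseteq> verts G"
  shows "(\<Sum>v\<in>A. deg G v) = 2 * card (edges G \<inter> all_edges A) + card (edges G \<inter> cut A (verts G - A))"
proof -
  let ?E = "edges G"
  have finE: "finite ?E" by (rule finite_edges[OF G])
  have finA: "finite A" using A G by (auto simp: simple_graph_def intro: finite_subset)
  have two: "e \<subseteq> verts G" "card e = 2" if "e \<in> ?E" for e
    using that G by (auto simp: simple_graph_def all_edges_def)
  have "(\<Sum>v\<in>A. deg G v) = (\<Sum>v\<in>A. \<Sum>e\<in>?E. of_bool (v \<in> e) :: nat)"
    using finE by (simp add: deg_def Int_def)
  also have "\<dots> = (\<Sum>e\<in>?E. \<Sum>v\<in>A. of_bool (v \<in> e) :: nat)"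
    by (rule sum.swap)
  also have "\<dots> = (\<Sum>e\<in>?E. 2 * of_bool (e \<in> all_edges A) + of_bool (e \<in> cut A (verts G - A)))"
  proof (rule sum.cong[OF refl])
    fix e assume e: "e \<in> ?E"
    obtain a b where ab: "e = {a, b}" "a \<noteq> b" using two(2)[OF e] by (auto simp: card_2_iff)
    have V: "a \<in> verts G" "b \<in> verts G" using two(1)[OF e] ab by auto
    have "(\<Sum>v\<in>A. of_bool (v \<in> e) :: nat) = card (A \<inter> e)" using finA by simp
    also have "\<dots> = of_bool (a \<in> A) + of_bool (b \<in> A)"
      unfolding ab(1) using ab(2) by (cases "a \<in> A"; cases "b \<in> A") (simp_all add: Int_insert_right)
    also have "\<dots> = 2 * of_bool (e \<in> all_edges A) + of_bool (e \<in> cut A (verts G - A))"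
    proof -
      have "e \<in> all_edges A \<longleftrightarrow> a \<in> A \<and> b \<in> A"
        using ab by (simp add: all_edges_def)
      moreover have "e \<in> cut A (verts G - A) \<longleftrightarrow> (a \<in> A \<and> b \<notin> A) \<or> (b \<in> A \<and> a \<notin> A)"
        using ab V unfolding cut_def by (auto simp: doubleton_eq_iff)
      ultimately show ?thesis by (simp add: of_bool_def)
    qed
    finally show "(\<Sum>v\<in>A. of_bool (v \<in> e) :: nat) = 2 * of_bool (e \<in> all_edges A) + of_bool (e \<in> cut A (verts G - A))" .
  qed
  also have "\<dots> = 2 * card (?E \<inter> all_edges A) + card (?E \<inter> cut A (verts G - A))"
    using finE by (simp add: sum.distrib flip: sum_distrib_left)
  finally show ?thesis .
qed

text \<open>The large vertices of a small closed set \<open>A\<close>, together with the separator \<open>S\<close>, span too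
  many edges.\<close>

lemma small_closed_set_impossible:
  fixes s b :: real
  assumes G: "simple_graph G" and G': "simple_graph G'" "spanning_subgraph G' G"
    and k: "k \<ge> 1" and s: "s \<ge> 8 * k"
    and small_adj: "\<And>u v. {u, v} \<in> edges G \<Longrightarrow> deg G u > s \<or> deg G v > s"
    and small_path: "\<And>u v w. u \<noteq> v \<Longrightarrow> {u, w} \<in> edges G \<Longrightarrow> {v, w} \<in> edges G \<Longrightarrow> deg G u > s \<or> deg G v > s"
    and sparse: "\<And>U. U \<subseteq> verts G \<Longrightarrow> U \<noteq> {} \<Longrightarrow> card U \<le> b \<Longrightarrow> card (edges G \<inter> all_edges U) < card U * s / 16"
    and deg_half: "\<And>v. v \<in> verts G \<Longrightarrow> real (deg G' v) \<ge> deg G v / 2"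
    and deg_k: "\<And>v. v \<in> verts G \<Longrightarrow> deg G' v \<ge> k"
    and S: "S \<subseteq> verts G" "card S < k" and A: "A \<subseteq> verts G - S" "A \<noteq> {}" "card A + k \<le> b"
    and closed: "\<And>v w. v \<in> A \<Longrightarrow> {v, w} \<in> edges G' \<Longrightarrow> w \<in> A \<union> S"
  shows False
proof -
  have sub: "edges G' \<subseteq> edges G" using G' by (simp add: spanning_subgraph_def)
  have finV: "finite (verts G)" using G by (simp add: simple_graph_def)
  have finA: "finite A" and finS: "finite S" using A S finV by (auto intro: finite_subset)
  define B where "B = {v \<in> A. deg G v > s}"
  define U where "U = B \<union> S"
  have finU: "finite U" "finite B" using finA finS by (auto simp: U_def B_def)
  have UV: "U \<subseteq> verts G" using A S by (auto simp: U_def B_def)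
  define nb where "nb v = {w. {v, w} \<in> edges G'}" for v
  have nb_V: "nb v \<subseteq> verts G" for v
    using sub G by (auto simp: nb_def simple_graph_def all_edges_def)
  have fin_nb: "finite (nb v)" for v using nb_V finV by (rule finite_subset)
  have card_nb: "card (nb v) = deg G' v" for v
    unfolding nb_def by (rule deg_eq_card_neighbours[OF G'(1), symmetric])
  \<comment> \<open>A vertex of \<open>A\<close> has at least \<open>k\<close> neighbours in
    \<open>G'\<close>, fewer than \<open>k\<close> of them in \<open>S\<close>, hence one in
    \<open>A\<close>; of two adjacent vertices one is large.\<close>
  have "B \<noteq> {}"
  proof -
    obtain v where v: "v \<in> A" using A by auto
    have "card (nb v) \<ge> k" using deg_k[of v] v A by (auto simp: card_nb)
    then have "\<not> nb v \<subseteq> S" using S card_mono[OF finS, of "nb v"] by auto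
    then obtain w where w: "w \<in> nb v" "w \<notin> S" by auto
    then have "w \<in> A" using closed[OF v, of w] by (auto simp: nb_def)
    moreover have "deg G v > s \<or> deg G w > s" using small_adj[of v w] w sub by (auto simp: nb_def)
    ultimately show ?thesis using v by (auto simp: B_def)
  qed
  \<comment> \<open>A large vertex keeps at least \<open>s / 2\<close> neighbours in
    \<open>G'\<close>, all in \<open>A \<union> S\<close>. Those outside \<open>U\<close> are small,
    and two of them would form a path of small vertices through \<open>v\<close>; hence the loss of
    1.\<close>
  have nbU: "card (nb v \<inter> U) \<ge> s / 2 - 1" if v: "v \<in> B" for v
  proof -
    have vA: "v \<in> A" using v by (simp add: B_def)
    have "nb v - U \<subseteq> {w \<in> nb v. \<not> deg G w > s}"
      using closed[OF vA] by (auto simp: nb_def U_def B_def)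
    moreover have "card {w \<in> nb v. \<not> deg G w > s} \<le> 1"
    proof (rule ccontr)
      assume "\<not> ?thesis"
      then have "card {w \<in> nb v. \<not> deg G w > s} \<ge> 2" by simp
      then obtain T where "T \<subseteq> {w \<in> nb v. \<not> deg G w > s}" "card T = 2"
        by (meson obtain_subset_with_card_n)
      then obtain x y where "x \<noteq> y" "x \<in> nb v" "y \<in> nb v" "\<not> deg G x > s" "\<not> deg G y > s"
        by (auto simp: card_2_iff)
      then show False using small_path[of x y v] sub by (auto simp: nb_def insert_commute)
    qed
    ultimately have "card (nb v - U) \<le> 1"
      using card_mono[of "{w \<in> nb v. \<not> deg G w > s}" "nb v - U"] fin_nb by (auto intro: le_trans)
    moreover have "card (nb v) = card (nb v \<inter> U) + card (nb v - U)"
      by (rule card_Int_Diff[OF fin_nb])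
    moreover have "real (card (nb v)) \<ge> s / 2"
      using deg_half[of v] v vA A by (auto simp: card_nb B_def)
    ultimately show ?thesis by linarith
  qed
  have E: "2 * card (edges G \<inter> all_edges U) \<ge> card B * (s / 2 - 1)"
  proof -
    \<comment> \<open>In the graph induced on \<open>U\<close> the cut term of
      \<open>sum_deg_eq\<close> is empty, which leaves the handshake identity.\<close>
    define GU where "GU = (U, edges G \<inter> all_edges U)"
    have simp_GU: "simple_graph GU" using finU by (simp add: GU_def simple_graph_def)
    have "card B * (s / 2 - 1) \<le> (\<Sum>v\<in>B. real (deg GU v))"
    proof (rule order_trans[OF _ sum_bounded_below[of B "s / 2 - 1"]])
      fix v assume v: "v \<in> B"
      have "nb v \<inter> U \<subseteq> {w. {v, w} \<in> edges GU}"
      proof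
        fix w assume w: "w \<in> nb v \<inter> U"
        then have "{v, w} \<in> edges G" using sub by (auto simp: nb_def)
        moreover from this have "card {v, w} = 2" using G by (auto simp: simple_graph_def all_edges_def)
        ultimately show "w \<in> {w. {v, w} \<in> edges GU}" using w v by (auto simp: GU_def all_edges_def U_def)
      qed
      moreover have "finite {w. {v, w} \<in> edges GU}"
        by (rule finite_subset[of _ U]) (use finU in \<open>auto simp: GU_def all_edges_def\<close>)
      ultimately have "card (nb v \<inter> U) \<le> deg GU v"
        unfolding deg_eq_card_neighbours[OF simp_GU] by (rule card_mono[rotated])
      then show "s / 2 - 1 \<le> real (deg GU v)" using nbU[OF v] by linarith
    qed simp
    also have "\<dots> \<le> (\<Sum>v\<in>U. real (deg GU v))"
      using finU by (intro sum_mono2) (auto simp: U_def)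
    also have "\<dots> = real (\<Sum>v\<in>U. deg GU v)" by simp
    also have "(\<Sum>v\<in>U. deg GU v) = 2 * card (edges G \<inter> all_edges U)"
      by (subst sum_deg_eq[OF simp_GU]) (auto simp: GU_def cut_def)
    finally show ?thesis by simp
  qed
  \<comment> \<open>The neighbours of one large vertex give \<open>U\<close> at least
    \<open>4 * k - 1\<close> elements, and fewer than \<open>k\<close> of them lie in
    \<open>S\<close>, so \<open>B\<close> is at least half of \<open>U\<close>.\<close>
  have cardU: "real (card U) \<le> 2 * card B"
  proof -
    obtain v where v: "v \<in> B" using \<open>B \<noteq> {}\<close> by auto
    have "s / 2 - 1 \<le> card U"
      using nbU[OF v] card_mono[OF finU(1), of "nb v \<inter> U"] by simp
    moreover have "card U \<le> card B + card S" unfolding U_def by (rule card_Un_le)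
    ultimately show ?thesis using s S k by linarith
  qed
  have "card U \<le> b"
  proof -
    have "card B \<le> card A" using finA by (intro card_mono) (auto simp: B_def)
    moreover have "card U \<le> card B + card S" unfolding U_def by (rule card_Un_le)
    ultimately show ?thesis using A S by linarith
  qed
  moreover have "U \<noteq> {}" using \<open>B \<noteq> {}\<close> by (auto simp: U_def)
  ultimately have lt: "card (edges G \<inter> all_edges U) < card U * s / 16" using sparse UV by blast
  \<comment> \<open>Chain of estimates: \<open>card U * s / 16\<close> is at most
    \<open>card B * s / 8\<close>, hence at most \<open>card B * (s / 2 - 1) / 2\<close>, hence at
    most the number of edges inside \<open>U\<close>, against sparsity.\<close>
  have "card U * s \<le> 2 * (card B * s)"
    using mult_right_mono[OF cardU, of s] s k by simp
  moreover have "card B * s \<le> 4 * (card B * (s / 2 - 1))"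
    using s k mult_left_mono[of "s / 4" "s / 2 - 1" "card B"] by simp
  ultimately show False using lt E by linarith
qed

text \<open>All edges leaving \<open>A\<close> belong to \<open>H\<close>, except at most
  \<open>k * card (verts G)\<close> that end in \<open>S\<close>. The degrees of \<open>H\<close>
  allow only \<open>(1 / 2 - \<epsilon>) * (2 + \<epsilon>)\<close> times the cut, which is at most
  \<open>1 - \<epsilon>\<close> times it, and the missing fraction \<open>\<epsilon>\<close> of the
  cut is larger than the exception.\<close>

lemma large_closed_set_impossible:
  fixes \<epsilon> :: real
  assumes G: "simple_graph G" and H: "spanning_subgraph H G"
    and eps: "0 < \<epsilon>" "\<epsilon> \<le> 1 / 2"
    and degH: "\<And>v. v \<in> verts G \<Longrightarrow> real (deg H v) \<le> (1 / 2 - \<epsilon>) * deg G v"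
    and A: "A \<subseteq> verts G" and S: "S \<subseteq> verts G" "card S < k"
    and bal: "2 * real (card (edges G \<inter> all_edges A)) \<le> (1 + \<epsilon>) * card (edges G \<inter> cut A (verts G - A))"
    and big: "card (edges G \<inter> cut A (verts G - A)) > k * card (verts G) / \<epsilon>"
    and closed: "\<And>v w. v \<in> A \<Longrightarrow> w \<in> verts G - A - S \<Longrightarrow> {v, w} \<in> edges G \<Longrightarrow> {v, w} \<in> edges H"
  shows False
proof -
  let ?X = "edges G \<inter> cut A (verts G - A)"
  have simpH: "simple_graph H" using G H by (auto simp: simple_graph_def spanning_subgraph_def)
  have finV: "finite (verts G)" using G by (simp add: simple_graph_def)
  have finA: "finite A" and finS: "finite S" using A S finV by (auto intro: finite_subset)
  have "?X \<subseteq> (edges H \<inter> cut A (verts H - A)) \<union> (\<lambda>(v, w). {v, w}) ` (A \<times> S)"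
  proof
    fix e assume e: "e \<in> ?X"
    then obtain v w where vw: "v \<in> A" "w \<in> verts G - A" "e = {v, w}" by (auto simp: cut_def)
    show "e \<in> (edges H \<inter> cut A (verts H - A)) \<union> (\<lambda>(v, w). {v, w}) ` (A \<times> S)"
    proof (cases "w \<in> S")
      case True
      then show ?thesis using vw by auto
    next
      case False
      then have "e \<in> edges H" using closed[of v w] vw e by auto
      moreover have "e \<in> cut A (verts H - A)"
        using vw H unfolding cut_def spanning_subgraph_def by auto
      ultimately show ?thesis by blast
    qed
  qed
  then have "card ?X \<le> card ((edges H \<inter> cut A (verts H - A)) \<union> (\<lambda>(v, w). {v, w}) ` (A \<times> S))"
    using finA finS finite_edges[OF simpH] by (intro card_mono) auto
  also have "\<dots> \<le> card (edges H \<inter> cut A (verts H - A)) + card ((\<lambda>(v, w). {v, w}) ` (A \<times> S))"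
    by (rule card_Un_le)
  also have "card ((\<lambda>(v, w). {v, w}) ` (A \<times> S)) \<le> card (A \<times> S)"
    using finA finS by (intro card_image_le) auto
  also have "card (A \<times> S) \<le> k * card (verts G)"
    using card_mono[OF finV A] S mult_mono[of "card S" k "card A" "card (verts G)"]
    by (simp add: card_cartesian_product mult.commute)
  also have "card (edges H \<inter> cut A (verts H - A)) \<le> (\<Sum>v\<in>A. deg H v)"
    using sum_deg_eq[OF simpH, of A] A H by (simp add: spanning_subgraph_def)
  finally have 1: "card ?X \<le> (\<Sum>v\<in>A. deg H v) + k * card (verts G)" by simp
  have "real (\<Sum>v\<in>A. deg H v) \<le> (\<Sum>v\<in>A. (1 / 2 - \<epsilon>) * deg G v)"
    using degH A by (auto intro!: sum_mono)
  also have "\<dots> = (1 / 2 - \<epsilon>) * real (\<Sum>v\<in>A. deg G v)"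
    by (simp add: sum_distrib_left)
  also have "\<dots> = (1 / 2 - \<epsilon>) * (2 * real (card (edges G \<inter> all_edges A)) + card ?X)"
    unfolding sum_deg_eq[OF G A] by simp
  also have "\<dots> \<le> (1 / 2 - \<epsilon>) * ((1 + \<epsilon>) * card ?X + card ?X)"
    using bal eps by (intro mult_left_mono) auto
  also have "\<dots> = (1 - \<epsilon>) * card ?X - (\<epsilon> / 2 + \<epsilon> * \<epsilon>) * card ?X"
    by (simp add: algebra_simps)
  also have "\<dots> \<le> (1 - \<epsilon>) * card ?X"
    using eps by simp
  finally have "real (card ?X) \<le> (1 - \<epsilon>) * card ?X + k * card (verts G)"
    using of_nat_mono[OF 1, where 'a = real] by simp
  then have "\<epsilon> * card ?X \<le> k * card (verts G)" by (simp add: algebra_simps)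
  then show False using big eps by (simp add: field_simps)
qed

text \<open>Interface between the deterministic and the probabilistic half: the last four
  assumptions are what the first moment estimates supply at the hitting time. The threshold
  \<open>b\<close> separates small from large closed sets.\<close>

lemma resilient_of_pseudorandom:
  fixes s b \<epsilon> :: real
  assumes G: "simple_graph G" and eps: "0 < \<epsilon>" "\<epsilon> \<le> 1 / 2" and k: "k \<ge> 1" and s: "s \<ge> 8 * k"
    and small_adj: "\<And>u v. {u, v} \<in> edges G \<Longrightarrow> deg G u > s \<or> deg G v > s"
    and small_path: "\<And>u v w. u \<noteq> v \<Longrightarrow> {u, w} \<in> edges G \<Longrightarrow> {v, w} \<in> edges G \<Longrightarrow> deg G u > s \<or> deg G v > s"
    and sparse: "\<And>U. U \<subseteq> verts G \<Longrightarrow> U \<noteq> {} \<Longrightarrow> card U \<le> b \<Longrightarrow> card (edges G \<inter> all_edges U) < card U * s / 16"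
    and balanced: "\<And>A. A \<subseteq> verts G \<Longrightarrow> 2 * card A \<le> card (verts G) \<Longrightarrow> card A + k > b \<Longrightarrow>
        2 * real (card (edges G \<inter> all_edges A)) \<le> (1 + \<epsilon>) * card (edges G \<inter> cut A (verts G - A)) \<and>
        card (edges G \<inter> cut A (verts G - A)) > k * card (verts G) / \<epsilon>"
  shows "resilient (1 / 2 - \<epsilon>) k (k_connected k) G"
  unfolding resilient_def
proof (intro allI impI)
  fix H assume "spanning_subgraph H G \<and>
    (\<forall>v\<in>verts G. real (deg H v) \<le> (1 / 2 - \<epsilon>) * real (deg G v) \<and> k \<le> deg (remove_edges_of G H) v)"
  then have H: "spanning_subgraph H G"
    and degH: "\<And>v. v \<in> verts G \<Longrightarrow> real (deg H v) \<le> (1 / 2 - \<epsilon>) * real (deg G v)"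
    and degG': "\<And>v. v \<in> verts G \<Longrightarrow> k \<le> deg (remove_edges_of G H) v" by auto
  define G' where "G' = remove_edges_of G H"
  have vG': "verts G' = verts G" and eG': "edges G' = edges G - edges H"
    by (auto simp: G'_def remove_edges_of_def)
  have G': "simple_graph G'" "spanning_subgraph G' G"
    using G by (auto simp: simple_graph_def spanning_subgraph_def vG' eG')
  have finV: "finite (verts G)" using G by (simp add: simple_graph_def)
  have deg_half: "real (deg G' v) \<ge> deg G v / 2" if v: "v \<in> verts G" for v
  proof -
    have "{e \<in> edges G. v \<in> e} = {e \<in> edges G'. v \<in> e} \<union> {e \<in> edges H. v \<in> e}"
      using H by (auto simp: eG' spanning_subgraph_def)
    then have "deg G v \<le> deg G' v + deg H v" unfolding deg_def by (metis card_Un_le)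
    moreover have "(1 / 2 - \<epsilon>) * real (deg G v) \<le> 1 / 2 * deg G v"
      using eps by (intro mult_right_mono) auto
    ultimately show ?thesis using degH[OF v] by linarith
  qed
  \<comment> \<open>Here \<open>A\<close> is the smaller side of a disconnected
    \<open>G' - S\<close>. Small sides are excluded by sparsity, large ones by balance.\<close>
  have no_closed: False
    if S: "S \<subseteq> verts G" "card S < k" and A: "A \<subseteq> verts G - S" "A \<noteq> {}" "2 * card A \<le> card (verts G)"
      and closed: "\<And>v w. v \<in> A \<Longrightarrow> w \<in> verts G - S - A \<Longrightarrow> {v, w} \<notin> edges G'" for S A
  proof (cases "card A + k \<le> b")
    case True
    show False
    proof (rule small_closed_set_impossible[OF G G' k s small_adj small_path sparse deg_half _ S A(1,2) True])
      fix v w assume "v \<in> A" "{v, w} \<in> edges G'"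
      moreover from this have "w \<in> verts G" using G by (auto simp: eG' simple_graph_def all_edges_def)
      ultimately show "w \<in> A \<union> S" using closed[of v w] by auto
    qed (use degG' in \<open>auto simp: G'_def\<close>)
  next
    case False
    have AV: "A \<subseteq> verts G" using A by auto
    show False
      by (rule large_closed_set_impossible[OF G H eps degH AV S])
        (use balanced[OF AV A(3)] closed False in \<open>auto simp: eG'\<close>)
  qed
  show "k_connected k (remove_edges_of G H)"
    unfolding k_connected_def
  proof (intro allI impI)
    fix S assume "S \<subseteq> verts (remove_edges_of G H)" and "finite S \<and> card S < k"
    then have S: "S \<subseteq> verts G" "card S < k" using vG' by (auto simp: G'_def)
    show "connected_graph (remove_vertices (remove_edges_of G H) S)"
    proof (rule ccontr)
      assume "\<not> ?thesis"
      then obtain C where C: "C \<subseteq> verts G - S" "C \<noteq> {}" "verts G - S - C \<noteq> {}"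
        and cl: "\<And>a b. a \<in> C \<Longrightarrow> b \<in> verts G - S - C \<Longrightarrow> {a, b} \<notin> edges (remove_vertices G' S)"
        by (rule not_connected_obtain_closed) (simp add: remove_vertices_def vG' flip: G'_def)
      have cl': "{a, b} \<notin> edges G'" if "a \<in> C" "b \<in> verts G - S - C" for a b
        using cl[OF that] that C by (auto simp: remove_vertices_def)
      let ?D = "verts G - S - C"
      have "card C + card ?D = card (C \<union> ?D)"
        using finV C by (intro card_Un_disjoint[symmetric]) (auto intro: finite_subset)
      also have "\<dots> \<le> card (verts G)"
        using finV C by (intro card_mono) auto
      finally consider "2 * card C \<le> card (verts G)" | "2 * card ?D \<le> card (verts G)" by linarith
      then show False
      proof cases
        case 1
        show False using no_closed[OF S C(1,2) 1] cl' by blast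
      next
        case 2
        have "{v, w} \<notin> edges G'" if "v \<in> ?D" "w \<in> verts G - S - ?D" for v w
          using cl'[of w v] that C by (auto simp: insert_commute)
        then show False using no_closed[OF S _ C(3) 2] by blast
      qed
    qed
  qed
qed

section \<open>Asymptotics of the exceptional events\<close>

text \<open>Any constant between \<open>1/4\<close> and \<open>1/2\<close> would do in place of \<open>3/8\<close>: below \<open>1/2\<close> isolated vertices
  remain, above \<open>1/4\<close> a given pair of vertices has small degrees with probability \<open>o(1 / (n ln\<^sup>2 n))\<close>.\<close>

definition lower_time :: "nat \<Rightarrow> nat" where
  "lower_time n = nat \<lfloor>3 / 8 * real n * ln (real n)\<rfloor>"

text \<open>At this time the average degree is about \<open>2 * ln n\<close>, so a given vertex has
  bounded degree with probability far below \<open>1 / n\<close>, and a union bound over vertices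
  succeeds.\<close>

definition upper_time :: "nat \<Rightarrow> nat" where
  "upper_time n = nat \<lceil>real n * ln (real n)\<rceil>"

section \<open>The time window compared with the number of possible edges\<close>

lemma real_choose_two: "real (n choose 2) = real n * (real n - 1) / 2"
proof -
  have "2 * (n choose 2) = n * (n - 1)"
    unfolding choose_two by (rule dvd_mult_div_cancel) (cases n; simp)
  then have "2 * real (n choose 2) = real n * real (n - 1)"
    by (metis of_nat_mult of_nat_numeral)
  then show ?thesis by (cases n) auto
qed

lemma lower_time_bounds:
  "real (lower_time n) \<le> 3 / 8 * real n * ln (real n)" "3 / 8 * real n * ln (real n) - 1 \<le> real (lower_time n)"
proof -
  have "ln (real n) \<ge> 0" by (cases n) auto
  then have "3 / 8 * real n * ln (real n) \<ge> 0" by simp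
  then show "real (lower_time n) \<le> 3 / 8 * real n * ln (real n)"
    "3 / 8 * real n * ln (real n) - 1 \<le> real (lower_time n)"
    unfolding lower_time_def by linarith+
qed

lemma upper_time_bounds:
  "real n * ln (real n) \<le> real (upper_time n)" "real (upper_time n) \<le> real n * ln (real n) + 1"
proof -
  have "ln (real n) \<ge> 0" by (cases n) auto
  then have "real n * ln (real n) \<ge> 0" by simp
  then show "real n * ln (real n) \<le> real (upper_time n)" "real (upper_time n) \<le> real n * ln (real n) + 1"
    unfolding upper_time_def by linarith+
qed

lemma lower_le_upper_time: "lower_time n \<le> upper_time n"
proof -
  have "ln (real n) \<ge> 0" by (cases n) auto
  then have "3 / 8 * real n * ln (real n) \<le> real n * ln (real n)" by (simp add: mult_right_mono)
  then show ?thesis unfolding lower_time_def upper_time_def by linarith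
qed

text \<open>The window ends after a vanishing fraction of all edges. The ratio of
  \<open>upper_time n\<close> to the number of edges still missing is about
  \<open>2 * ln n / n\<close>; the constant 3 absorbs lower-order terms.\<close>

lemma upper_time_ratio:
  assumes "c > 0"
  shows "eventually (\<lambda>n. upper_time n < n choose 2 \<and>
    real (upper_time n) \<le> c * real (n choose 2) \<and>
    real (upper_time n) \<le> 3 * ln n / n * (real (n choose 2) - upper_time n)) at_top"
proof -
  have "eventually (\<lambda>n. real n * ln n + 1 < real n * (real n - 1) / 2) at_top"
    by real_asymp
  moreover have "eventually (\<lambda>n. real n * ln n + 1 \<le> c * (real n * (real n - 1) / 2)) at_top"
    using assms by real_asymp
  moreover have "eventually (\<lambda>n. real n * ln n + 1 \<le> 3 * ln n / n * (real n * (real n - 1) / 2 - (real n * ln n + 1))) at_top"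
    by real_asymp
  moreover have "eventually (\<lambda>n::nat. n \<ge> 1) at_top" by (rule eventually_ge_at_top)
  ultimately show ?thesis
  proof eventually_elim
    case (elim n)
    have "real (upper_time n) < real (n choose 2)"
      using elim upper_time_bounds[of n] unfolding real_choose_two by linarith
    moreover have "real (upper_time n) \<le> c * real (n choose 2)"
      using elim upper_time_bounds[of n] unfolding real_choose_two by linarith
    moreover have "real (upper_time n) \<le> 3 * ln n / n * (real (n choose 2) - upper_time n)"
    proof -
      have "3 * ln n / n * (real n * (real n - 1) / 2 - (real n * ln n + 1))
          \<le> 3 * ln n / n * (real (n choose 2) - upper_time n)"
        using elim upper_time_bounds[of n] unfolding real_choose_two by (intro mult_left_mono) auto
      then show ?thesis using elim upper_time_bounds[of n] by linarith
    qed
    ultimately show ?case by simp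
  qed
qed

section \<open>Existence of isolated vertices at the lower time\<close>

lemma tendsto_0_le:
  fixes f g :: "nat \<Rightarrow> real"
  assumes "eventually (\<lambda>n. f n \<le> g n) at_top" "g \<longlonglongrightarrow> 0" "\<And>n. 0 \<le> f n"
  shows "f \<longlonglongrightarrow> 0"
  by (rule tendsto_sandwich[of "\<lambda>_. 0" f at_top g 0]) (use assms in auto)

text \<open>With \<open>3 / 8 * n * ln n\<close> edges a vertex is isolated with probability about
  \<open>n powr (- 3 / 4)\<close>, so the expected number of isolated vertices grows like
  \<open>n powr (1 / 4)\<close>, while the correlation term is of order
  \<open>ln n / n\<close>.\<close>

lemma prob_no_isolated_tendsto:
  "(\<lambda>n. measure_pmf.prob (random_graph_process n) {Gs. \<forall>v<n. deg (Gs ! lower_time n) v \<noteq> 0}) \<longlonglongrightarrow> 0"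
proof -
  \<comment> \<open>Floor-free stand-ins: \<open>T n\<close> dominates \<open>lower_time n\<close>,
    and \<open>1 - Y n\<close> bounds every factor of the product \<open>q\<close> from below, so
    the limit of \<open>g\<close> is that of an elementary function.\<close>
  define T where "T n = 3 / 8 * real n * ln (real n)" for n
  define Nr where "Nr n = real n * (real n - 1) / 2" for n
  define Y where "Y n = (real n - 1) / (Nr n - T n)" for n
  define g where "g n = 1 / exp (ln n - T n * (Y n + 2 * (Y n)\<^sup>2)) + (exp (T n * Nr n / (Nr n - T n - n)\<^sup>2) - 1)" for n
  have g0: "g \<longlonglongrightarrow> 0" unfolding g_def Y_def Nr_def T_def by real_asymp
  have "eventually (\<lambda>n. measure_pmf.prob (random_graph_process n) {Gs. \<forall>v<n. deg (Gs ! lower_time n) v \<noteq> 0} \<le> g n) at_top"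
  proof -
    have e1: "eventually (\<lambda>n. 2 * real n + T n < Nr n) at_top" unfolding T_def Nr_def by real_asymp
    have e2: "eventually (\<lambda>n. Y n \<le> 1 / 2) at_top" unfolding Y_def T_def Nr_def by real_asymp
    show ?thesis using e1 e2 eventually_ge_at_top[of 2]
    proof eventually_elim
      case (elim n)
      let ?m = "lower_time n"
      have N: "real (n choose 2) = Nr n" by (simp add: real_choose_two Nr_def)
      have m: "real ?m \<le> T n" using lower_time_bounds[of n] by (simp add: T_def)
      then have "real (2 * n + ?m) < real (n choose 2)" using elim unfolding N by simp
      then have mN: "2 * n + ?m < n choose 2" by simp
      define q where "q = (\<Prod>j<?m. 1 - (real n - 1) / (real (n choose 2) - real j))"
      have T: "T n \<ge> 0" using elim by (simp add: T_def)
      have Nr: "Nr n - T n > 0" using elim by linarith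
      have Y0: "Y n \<ge> 0" using elim Nr by (simp add: Y_def)
      have "exp (- T n * (Y n + 2 * (Y n)\<^sup>2)) \<le> q"
      proof -
        have "exp (- T n * (Y n + 2 * (Y n)\<^sup>2)) \<le> exp (- real ?m * (Y n + 2 * (Y n)\<^sup>2))"
          using m Y0 by (simp add: mult_right_mono)
        also have "\<dots> = exp (- Y n - 2 * (Y n)\<^sup>2) ^ ?m"
          by (simp add: exp_of_nat_mult[symmetric] algebra_simps)
        also have "\<dots> \<le> (1 - Y n) ^ ?m"
        proof (rule power_mono)
          have "- Y n - 2 * (Y n)\<^sup>2 \<le> ln (1 - Y n)"
            using Y0 elim by (intro ln_one_minus_pos_lower_bound) auto
          then show "exp (- Y n - 2 * (Y n)\<^sup>2) \<le> 1 - Y n"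
            using elim by (subst (asm) ln_ge_iff) auto
        qed simp
        also have "\<dots> = (\<Prod>j<?m. 1 - Y n)" by simp
        also have "\<dots> \<le> q" unfolding q_def
        proof (rule prod_mono, intro conjI)
          fix j assume "j \<in> {..<?m}"
          then have "Nr n - T n \<le> real (n choose 2) - real j" using m unfolding N by simp
          then have "(real n - 1) / (real (n choose 2) - real j) \<le> Y n"
            unfolding Y_def using elim Nr by (intro divide_left_mono mult_pos_pos) auto
          then show "1 - Y n \<le> 1 - (real n - 1) / (real (n choose 2) - real j)" by simp
        qed (use elim in auto)
        finally show ?thesis .
      qed
      then have "real n * exp (- T n * (Y n + 2 * (Y n)\<^sup>2)) \<le> real n * q" by (intro mult_left_mono) auto
      also have "real n * exp (- T n * (Y n + 2 * (Y n)\<^sup>2)) = exp (ln n - T n * (Y n + 2 * (Y n)\<^sup>2))"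
      proof -
        have "exp (ln n - T n * (Y n + 2 * (Y n)\<^sup>2)) = exp (ln (real n)) * exp (- T n * (Y n + 2 * (Y n)\<^sup>2))"
          unfolding exp_add[symmetric] by simp
        then show ?thesis using elim by simp
      qed
      finally have nq: "exp (ln n - T n * (Y n + 2 * (Y n)\<^sup>2)) \<le> real n * q" .
      have "measure_pmf.prob (random_graph_process n) {Gs. \<forall>v<n. deg (Gs ! ?m) v \<noteq> 0} \<le>
         1 / (real n * q) + (exp (?m * Nr n / (Nr n - ?m - n)\<^sup>2) - 1)"
        using prob_no_isolated_le[OF mN] elim unfolding q_def N by simp
      also have "\<dots> \<le> g n"
        unfolding g_def
      proof (intro add_mono diff_mono order_refl)
        show "1 / (real n * q) \<le> 1 / exp (ln n - T n * (Y n + 2 * (Y n)\<^sup>2))"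
          using nq by (rule frac_le[OF zero_le_one order_refl exp_gt_zero])
        have "?m * Nr n / (Nr n - ?m - n)\<^sup>2 \<le> T n * Nr n / (Nr n - T n - n)\<^sup>2"
          using m elim T Nr by (intro frac_le mult_right_mono power_mono) auto
        then show "exp (?m * Nr n / (Nr n - ?m - n)\<^sup>2) \<le> exp (T n * Nr n / (Nr n - T n - n)\<^sup>2)" by simp
      qed
      finally show ?case .
    qed
  qed
  then show ?thesis using g0 by (rule tendsto_0_le) simp
qed

text \<open>The degree estimates take \<open>exp (- 2)\<close> as the base \<open>x\<close> of the
  lower tail, so that \<open>1 - x\<close> is at least \<open>4 / 5\<close>.\<close>

lemma exp_minus_two_le: "exp (- 2 :: real) \<le> 1 / 5"
  using exp_lower_Taylor_quadratic[of "2 :: real"] by (simp add: exp_minus field_simps)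

section \<open>Vertices of low degree\<close>

lemma trajectory_deg:
  assumes "trajectory n i Gs" "m \<le> i"
  shows "deg (Gs ! m) v = card (edges (Gs ! m) \<inter> star n v)" "finite (edges (Gs ! m))"
proof -
  have "edges (Gs ! m) \<subseteq> all_edges {..<n}" using assms by (simp add: trajectory_def)
  then show "deg (Gs ! m) v = card (edges (Gs ! m) \<inter> star n v)" "finite (edges (Gs ! m))"
    using deg_eq_card_star[of "Gs ! m" n] finite_all_edges[of "{..<n}"] by (auto intro: finite_subset)
qed

lemma prob_process_mono:
  assumes "\<And>Gs. trajectory n (n choose 2) Gs \<Longrightarrow> P Gs \<Longrightarrow> Q Gs"
  shows "measure_pmf.prob (random_graph_process n) {Gs. P Gs} \<le> measure_pmf.prob (random_graph_process n) {Gs. Q Gs}"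
proof (rule measure_pmf.finite_measure_mono_AE)
  show "AE Gs in measure_pmf (random_graph_process n). Gs \<in> {Gs. P Gs} \<longrightarrow> Gs \<in> {Gs. Q Gs}"
    using assms trajectory_process[OF order_refl, of _ n]
    by (auto simp: AE_measure_pmf_iff random_graph_process_def)
qed simp

lemma prob_process_Ex_le:
  assumes "finite I" "\<And>i. i \<in> I \<Longrightarrow> measure_pmf.prob (random_graph_process n) {Gs. P i Gs} \<le> c i"
  shows "measure_pmf.prob (random_graph_process n) {Gs. \<exists>i\<in>I. P i Gs} \<le> (\<Sum>i\<in>I. c i)"
proof -
  have "{Gs. \<exists>i\<in>I. P i Gs} = (\<Union>i\<in>I. {Gs. P i Gs})" by auto
  then have "measure_pmf.prob (random_graph_process n) {Gs. \<exists>i\<in>I. P i Gs}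
     \<le> (\<Sum>i\<in>I. measure_pmf.prob (random_graph_process n) {Gs. P i Gs})"
    using measure_UNION_le[OF assms(1), of "\<lambda>i. {Gs. P i Gs}" "measure_pmf (random_graph_process n)"] by simp
  also have "\<dots> \<le> (\<Sum>i\<in>I. c i)" by (rule sum_mono) (rule assms(2))
  finally show ?thesis .
qed

text \<open>Union bound over vertices: each one fails with probability at most a constant times
  \<open>n powr (- 6 / 5)\<close>, the exponent being \<open>4 / 5 * (3 / 2)\<close>.\<close>

lemma prob_low_degree_tendsto:
  "(\<lambda>n. measure_pmf.prob (random_graph_process n) {Gs. \<exists>v\<in>{..<n}. deg (Gs ! upper_time n) v < k}) \<longlonglongrightarrow> 0"
proof -
  have "eventually (\<lambda>n. measure_pmf.prob (random_graph_process n) {Gs. \<exists>v\<in>{..<n}. deg (Gs ! upper_time n) v < k}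
    \<le> exp (2 * real k) * (real n * exp (- (4 / 5) * (3 / 2 * ln n)))) at_top"
    using upper_time_ratio[of 1, OF zero_less_one] eventually_ge_at_top[of "4 * k + 5"]
  proof eventually_elim
    case (elim n)
    let ?m = "upper_time n"
    have mN: "?m < n choose 2" using elim by auto
    then have N: "real (n choose 2) > 0" by linarith
    have l: "ln (real n) \<ge> 0" using elim by simp
    have "measure_pmf.prob (random_graph_process n) {Gs. \<exists>v\<in>{..<n}. deg (Gs ! ?m) v < k}
       \<le> (\<Sum>v\<in>{..<n}. exp (2 * real k) * exp (- (4 / 5) * (3 / 2 * ln n)))"
    proof (rule prob_process_Ex_le)
      fix v assume v: "v \<in> {..<n}"
      have "measure_pmf.prob (random_graph_process n) {Gs. deg (Gs ! ?m) v < k}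
         \<le> measure_pmf.prob (random_graph_process n) {Gs. card (edges (Gs ! ?m) \<inter> star n v) \<le> real k}"
        by (rule prob_process_mono) (use mN in \<open>simp add: trajectory_deg\<close>)
      also have "\<dots> \<le> exp (- 2) powr (- real k) *
          exp (- (1 - exp (- 2)) * real ?m * (card (star n v) - real k) / real (n choose 2))"
        by (rule process_lower_tail[OF mN star_subset]) (use v elim in \<open>auto simp: card_star\<close>)
      also have "exp (- 2) powr (- real k) = exp (2 * real k)" by (simp add: powr_def)
      also have "exp (- (1 - exp (- 2)) * real ?m * (card (star n v) - real k) / real (n choose 2))
         \<le> exp (- (4 / 5) * (3 / 2 * ln n))"
      proof -
        \<comment> \<open>The mean degree is about \<open>2 * ln n\<close>; the smaller constant
          \<open>3 / 2\<close> pays for subtracting \<open>k\<close>, since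
          \<open>n \<ge> 4 * k + 5\<close> makes \<open>n - 1 - k\<close> at least three quarters of
          \<open>n - 1\<close>.\<close>
        have "3 / 2 * ln (real n) * real (n choose 2) = real n * ln (real n) * (3 / 4 * (real n - 1))"
          by (simp add: real_choose_two)
        also have "\<dots> \<le> real ?m * (card (star n v) - real k)"
          using v elim l upper_time_bounds[of n] by (intro mult_mono) (auto simp: card_star of_nat_diff)
        finally have "3 / 2 * ln (real n) \<le> real ?m * (card (star n v) - real k) / real (n choose 2)"
          unfolding pos_le_divide_eq[OF N] .
        then have "(4 / 5) * (3 / 2 * ln (real n)) \<le> (1 - exp (- 2)) * (real ?m * (card (star n v) - real k) / real (n choose 2))"
          using exp_minus_two_le l by (intro mult_mono) auto
        moreover have "- (1 - exp (- 2)) * real ?m * (card (star n v) - real k) / real (n choose 2)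
          = - ((1 - exp (- 2)) * (real ?m * (card (star n v) - real k) / real (n choose 2)))"
          by (simp only: mult_minus_left mult.assoc times_divide_eq_right minus_divide_left)
        ultimately show ?thesis unfolding exp_le_cancel_iff by linarith
      qed
      finally show "measure_pmf.prob (random_graph_process n) {Gs. deg (Gs ! ?m) v < k}
         \<le> exp (2 * real k) * exp (- (4 / 5) * (3 / 2 * ln n))" by simp
    qed simp
    then show ?case by (simp add: mult_ac)
  qed
  moreover have "(\<lambda>n. exp (2 * real k) * (real n * exp (- (4 / 5) * (3 / 2 * ln n)))) \<longlonglongrightarrow> 0"
    by (rule tendsto_mult_right_zero) real_asymp
  ultimately show ?thesis by (rule tendsto_0_le) simp
qed

text \<open>Combines low degrees at the early time with prescribed edges at the late time through
  \<open>process_joint_tail\<close>. Each prescribed edge costs a factor of about its own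
  probability. The exponent is \<open>1.08 = 4 / 5 * 1.4 - 1 / 25\<close>, where
  \<open>1 / 25\<close> comes from allowing up to \<open>ln n / 50\<close> edges.\<close>

lemma prob_low_degree_pair_le:
  "eventually (\<lambda>n. \<forall>u<n. \<forall>v<n. \<forall>F. u \<noteq> v \<longrightarrow> F \<subseteq> all_edges {..<n} \<longrightarrow> card F \<le> 2 \<longrightarrow>
     measure_pmf.prob (random_graph_process n) {Gs. deg (Gs ! lower_time n) u \<le> ln n / 100 \<and>
        deg (Gs ! lower_time n) v \<le> ln n / 100 \<and> F \<subseteq> edges (Gs ! upper_time n)}
     \<le> (3 * ln n / n) ^ card F * exp (2 - 1.08 * ln n)) at_top"
proof -
  have "eventually (\<lambda>n. real n * (real n - 1) / 2 * (1.4 * ln n) \<le>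
     (3 / 8 * real n * ln n - 1) * (2 * real n - 5 - ln n / 50)) at_top"
    by real_asymp
  moreover have "eventually (\<lambda>n. 2 * real n - 5 \<ge> ln n / 50) at_top" by real_asymp
  ultimately show ?thesis
    using upper_time_ratio[of 1, OF zero_less_one] eventually_ge_at_top[of 2]
  proof eventually_elim
    case (elim n)
    let ?m1 = "lower_time n" and ?m2 = "upper_time n"
    have mN: "?m2 < n choose 2" using elim by auto
    then have N: "real (n choose 2) > 0" by linarith
    have l: "ln (real n) > 0" using elim by simp
    have m2: "?m2 > 0"
      using upper_time_bounds(1)[of n] mult_pos_pos[of "real n" "ln n"] l elim by linarith
    show ?case
    proof (intro allI impI)
      fix u v F assume uv: "u < n" "v < n" "u \<noteq> v" and F: "F \<subseteq> all_edges {..<n}" "card F \<le> 2"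
      \<comment> \<open>Removing \<open>F\<close> makes the two edge sets disjoint and costs at most
        two edges.\<close>
      define D where "D = star n u \<union> star n v - F"
      \<comment> \<open>This choice makes the growth exponent for \<open>F\<close> equal to
        \<open>card F\<close>, while \<open>1 / L\<close> is at most
        \<open>3 * ln n / n\<close>.\<close>
      define L where "L = real (n choose 2) / ?m2"
      have finF: "finite F" using F finite_all_edges finite_lessThan by (metis finite_subset)
      have L: "L \<ge> 1" using mN m2 by (simp add: L_def)
      have D: "D \<subseteq> all_edges {..<n}" using star_subset by (auto simp: D_def)
      have "real (card (star n u \<union> star n v)) - 2 \<le> card D"
        using diff_card_le_card_Diff[OF finF, of "star n u \<union> star n v"] F unfolding D_def by linarith
      then have cD: "2 * real n - 5 \<le> card D" by (simp add: card_star_Un[OF uv])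
      have "measure_pmf.prob (random_graph_process n) {Gs. deg (Gs ! ?m1) u \<le> ln n / 100 \<and>
        deg (Gs ! ?m1) v \<le> ln n / 100 \<and> F \<subseteq> edges (Gs ! ?m2)}
       \<le> measure_pmf.prob (random_graph_process n)
          {Gs. card (edges (Gs ! ?m1) \<inter> D) \<le> ln n / 50 \<and> real (card F) \<le> card (edges (Gs ! ?m2) \<inter> F)}"
      proof (rule prob_process_mono)
        fix Gs assume t: "trajectory n (n choose 2) Gs" and
          a: "deg (Gs ! ?m1) u \<le> ln n / 100 \<and> deg (Gs ! ?m1) v \<le> ln n / 100 \<and> F \<subseteq> edges (Gs ! ?m2)"
        have "?m1 \<le> n choose 2" using mN lower_le_upper_time[of n] by simp
        note d = trajectory_deg[OF t this]
        have "card (edges (Gs ! ?m1) \<inter> D) \<le> card ((edges (Gs ! ?m1) \<inter> star n u) \<union> (edges (Gs ! ?m1) \<inter> star n v))"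
          using d(2) by (intro card_mono) (auto simp: D_def)
        also have "\<dots> \<le> deg (Gs ! ?m1) u + deg (Gs ! ?m1) v"
          unfolding d(1) by (rule card_Un_le)
        finally have "card (edges (Gs ! ?m1) \<inter> D) \<le> ln n / 50" using a by linarith
        moreover have "edges (Gs ! ?m2) \<inter> F = F" using a by auto
        ultimately show "card (edges (Gs ! ?m1) \<inter> D) \<le> ln n / 50 \<and> real (card F) \<le> card (edges (Gs ! ?m2) \<inter> F)"
          by simp
      qed
      also have "\<dots> \<le> exp (- 2) powr (- (ln n / 50)) * L powr (- real (card F)) *
         exp (- (1 - exp (- 2)) * ?m1 * (card D - ln n / 50) / real (n choose 2)
            + (L - 1) * card F * ?m2 / (real (n choose 2) - ?m2))"
        by (rule process_joint_tail[OF lower_le_upper_time mN D F(1)]) (use L cD elim in \<open>auto simp: D_def\<close>)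
      also have "exp (- 2) powr (- (ln n / 50)) = exp (ln n / 25)" by (simp add: powr_def)
      also have "L powr (- real (card F)) = (1 / L) ^ card F"
        using L by (simp add: powr_minus powr_realpow power_one_over inverse_eq_divide)
      also have "(L - 1) * card F * ?m2 / (real (n choose 2) - ?m2) = card F"
        using mN m2 by (simp add: L_def field_simps)
      also have "exp (ln n / 25) * (1 / L) ^ card F *
          exp (- (1 - exp (- 2)) * ?m1 * (card D - ln n / 50) / real (n choose 2) + card F)
        \<le> exp (ln n / 25) * (3 * ln n / n) ^ card F * exp (- (4 / 5) * (1.4 * ln n) + 2)"
      proof (intro mult_mono)
        have "real ?m2 \<le> 3 * ln n / n * real (n choose 2)"
        proof -
          have "3 * ln n / n * (real (n choose 2) - ?m2) \<le> 3 * ln n / n * real (n choose 2)"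
            using l by (intro mult_left_mono) auto
          then show ?thesis using elim by linarith
        qed
        then have "1 / L \<le> 3 * ln n / n" using pos_divide_le_eq[OF N] by (simp add: L_def)
        then show "(1 / L) ^ card F \<le> (3 * ln n / n) ^ card F" using L by (intro power_mono) auto
        \<comment> \<open>The right-hand side divided by \<open>n choose 2\<close> is asymptotically
          \<open>3 / 2 * ln n\<close>, so \<open>1.4\<close> leaves room for lower-order
          terms.\<close>
        have "1.4 * ln n * real (n choose 2) \<le> (3 / 8 * real n * ln n - 1) * (2 * real n - 5 - ln n / 50)"
          using elim by (simp add: real_choose_two mult_ac)
        also have "\<dots> \<le> ?m1 * (card D - ln n / 50)"
          using lower_time_bounds[of n] cD elim by (intro mult_mono) auto
        finally have "1.4 * ln n \<le> ?m1 * (card D - ln n / 50) / real (n choose 2)"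
          unfolding pos_le_divide_eq[OF N] .
        then have "(4 / 5) * (1.4 * ln n) \<le> (1 - exp (- 2)) * (?m1 * (card D - ln n / 50) / real (n choose 2))"
          using exp_minus_two_le l by (intro mult_mono) auto
        moreover have "- (1 - exp (- 2)) * ?m1 * (card D - ln n / 50) / real (n choose 2)
          = - ((1 - exp (- 2)) * (?m1 * (card D - ln n / 50) / real (n choose 2)))"
          by (simp only: mult_minus_left mult.assoc times_divide_eq_right minus_divide_left)
        moreover have "real (card F) \<le> 2" using F by simp
        ultimately show "exp (- (1 - exp (- 2)) * ?m1 * (card D - ln n / 50) / real (n choose 2) + card F)
          \<le> exp (- (4 / 5) * (1.4 * ln n) + 2)" unfolding exp_le_cancel_iff by linarith
      qed (use l L in auto)
      also have "\<dots> = (3 * ln n / n) ^ card F * exp (2 - 1.08 * ln n)"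
        by (simp add: mult_ac flip: exp_add)
      finally show "measure_pmf.prob (random_graph_process n) {Gs. deg (Gs ! ?m1) u \<le> ln n / 100 \<and>
        deg (Gs ! ?m1) v \<le> ln n / 100 \<and> F \<subseteq> edges (Gs ! ?m2)}
        \<le> (3 * ln n / n) ^ card F * exp (2 - 1.08 * ln n)" .
    qed
  qed
qed

text \<open>Union bound over pairs: the two vertex choices and the one edge leave a factor of order
  \<open>n * ln n\<close>, which loses to \<open>n powr (- 1.08)\<close>.\<close>

lemma prob_low_degree_adjacent_tendsto:
  "(\<lambda>n. measure_pmf.prob (random_graph_process n) {Gs. \<exists>(u, v)\<in>{..<n} \<times> {..<n}. u \<noteq> v \<and>
     deg (Gs ! lower_time n) u \<le> ln n / 100 \<and> deg (Gs ! lower_time n) v \<le> ln n / 100 \<and>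
     {u, v} \<in> edges (Gs ! upper_time n)}) \<longlonglongrightarrow> 0"
proof -
  have "eventually (\<lambda>n. measure_pmf.prob (random_graph_process n) {Gs. \<exists>(u, v)\<in>{..<n} \<times> {..<n}. u \<noteq> v \<and>
     deg (Gs ! lower_time n) u \<le> ln n / 100 \<and> deg (Gs ! lower_time n) v \<le> ln n / 100 \<and>
     {u, v} \<in> edges (Gs ! upper_time n)} \<le> real n * real n * ((3 * ln n / n) * exp (2 - 1.08 * ln n))) at_top"
    using prob_low_degree_pair_le eventually_ge_at_top[of 2]
  proof eventually_elim
    case (elim n)
    define c where "c = (3 * ln n / n) * exp (2 - 1.08 * ln n)"
    have c: "c \<ge> 0" using elim by (simp add: c_def)
    have "measure_pmf.prob (random_graph_process n) {Gs. \<exists>p\<in>{..<n} \<times> {..<n}. case p of (u, v) \<Rightarrow> u \<noteq> v \<and>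
     deg (Gs ! lower_time n) u \<le> ln n / 100 \<and> deg (Gs ! lower_time n) v \<le> ln n / 100 \<and>
     {u, v} \<in> edges (Gs ! upper_time n)} \<le> (\<Sum>p\<in>{..<n} \<times> {..<n}. c)"
    proof (rule prob_process_Ex_le)
      fix p assume "p \<in> {..<n} \<times> {..<n}"
      then obtain u v where p: "p = (u, v)" "u < n" "v < n" by auto
      show "measure_pmf.prob (random_graph_process n) {Gs. case p of (u, v) \<Rightarrow> u \<noteq> v \<and>
         deg (Gs ! lower_time n) u \<le> ln n / 100 \<and> deg (Gs ! lower_time n) v \<le> ln n / 100 \<and>
         {u, v} \<in> edges (Gs ! upper_time n)} \<le> c"
      proof (cases "u = v")
        case False
        then have "{{u, v}} \<subseteq> all_edges {..<n}" using p by (simp add: all_edges_def)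
        with elim(1)[rule_format, of u v "{{u, v}}"] False p show ?thesis by (simp add: c_def)
      qed (use p c in simp)
    qed simp
    then show ?case by (simp add: c_def card_cartesian_product)
  qed
  moreover have "(\<lambda>n. real n * real n * ((3 * ln n / n) * exp (2 - 1.08 * ln n))) \<longlonglongrightarrow> 0"
    by real_asymp
  ultimately show ?thesis by (rule tendsto_0_le) simp
qed

text \<open>The middle vertex adds a factor \<open>n\<close> and the second edge one of order
  \<open>ln n / n\<close>, so compared with adjacent pairs only another logarithm is lost.\<close>

lemma prob_low_degree_path_tendsto:
  "(\<lambda>n. measure_pmf.prob (random_graph_process n) {Gs. \<exists>(u, v, w)\<in>{..<n} \<times> {..<n} \<times> {..<n}. u \<noteq> v \<and>
     deg (Gs ! lower_time n) u \<le> ln n / 100 \<and> deg (Gs ! lower_time n) v \<le> ln n / 100 \<and>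
     {u, w} \<in> edges (Gs ! upper_time n) \<and> {v, w} \<in> edges (Gs ! upper_time n)}) \<longlonglongrightarrow> 0"
proof -
  have "eventually (\<lambda>n. measure_pmf.prob (random_graph_process n) {Gs. \<exists>(u, v, w)\<in>{..<n} \<times> {..<n} \<times> {..<n}. u \<noteq> v \<and>
     deg (Gs ! lower_time n) u \<le> ln n / 100 \<and> deg (Gs ! lower_time n) v \<le> ln n / 100 \<and>
     {u, w} \<in> edges (Gs ! upper_time n) \<and> {v, w} \<in> edges (Gs ! upper_time n)}
     \<le> real n * (real n * real n) * ((3 * ln n / n)\<^sup>2 * exp (2 - 1.08 * ln n))) at_top"
    using prob_low_degree_pair_le upper_time_ratio[of 1, OF zero_less_one] eventually_ge_at_top[of 2]
  proof eventually_elim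
    case (elim n)
    define c where "c = (3 * ln n / n)\<^sup>2 * exp (2 - 1.08 * ln n)"
    have c: "c \<ge> 0" using elim by (simp add: c_def)
    let ?P = "\<lambda>u v w Gs. u \<noteq> v \<and>
     deg (Gs ! lower_time n) u \<le> ln n / 100 \<and> deg (Gs ! lower_time n) v \<le> ln n / 100 \<and>
     {u, w} \<in> edges (Gs ! upper_time n) \<and> {v, w} \<in> edges (Gs ! upper_time n)"
    have "measure_pmf.prob (random_graph_process n) {Gs. \<exists>p\<in>{..<n} \<times> {..<n} \<times> {..<n}. case p of (u, v, w) \<Rightarrow> ?P u v w Gs}
       \<le> (\<Sum>p\<in>{..<n} \<times> {..<n} \<times> {..<n}. c)"
    proof (rule prob_process_Ex_le)
      fix p assume "p \<in> {..<n} \<times> {..<n} \<times> {..<n}"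
      then obtain u v w where p: "p = (u, v, w)" "u < n" "v < n" "w < n" by auto
      have "measure_pmf.prob (random_graph_process n) {Gs. ?P u v w Gs} \<le> c"
      proof (cases "u \<noteq> v \<and> u \<noteq> w \<and> v \<noteq> w")
        case True
        let ?F = "{{u, w}, {v, w}}"
        have F: "?F \<subseteq> all_edges {..<n}" using p True by (simp add: all_edges_def)
        have cF: "card ?F = 2" using True by (simp add: doubleton_eq_iff)
        have "measure_pmf.prob (random_graph_process n) {Gs. ?P u v w Gs} \<le>
          measure_pmf.prob (random_graph_process n) {Gs. deg (Gs ! lower_time n) u \<le> ln n / 100 \<and>
            deg (Gs ! lower_time n) v \<le> ln n / 100 \<and> ?F \<subseteq> edges (Gs ! upper_time n)}"
          by (rule prob_process_mono) auto
        also have "\<dots> \<le> (3 * ln n / n) ^ card ?F * exp (2 - 1.08 * ln n)"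
          by (rule elim(1)[rule_format]) (use p True F cF in auto)
        finally show ?thesis unfolding c_def cF .
      next
        case False
        \<comment> \<open>Degenerate triples have probability 0: if \<open>w\<close> equals
          \<open>u\<close> or \<open>v\<close>, one of the two sets is a singleton and no
          edge.\<close>
        have "measure_pmf.prob (random_graph_process n) {Gs. ?P u v w Gs} \<le>
          measure_pmf.prob (random_graph_process n) {Gs. False}"
        proof (rule prob_process_mono)
          fix Gs assume t: "trajectory n (n choose 2) Gs" and P: "?P u v w Gs"
          have "edges (Gs ! upper_time n) \<subseteq> all_edges {..<n}" using t elim by (simp add: trajectory_def)
          then have "card {u, w} = 2" "card {v, w} = 2" using P by (auto simp: all_edges_def)
          then show False using False P by (auto split: if_splits)
        qed
        then show ?thesis using c by simp
      qed
      then show "measure_pmf.prob (random_graph_process n) {Gs. case p of (u, v, w) \<Rightarrow> ?P u v w Gs} \<le> c"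
        by (simp add: p)
    qed simp
    then show ?case by (simp add: c_def card_cartesian_product)
  qed
  moreover have "(\<lambda>n. real n * (real n * real n) * ((3 * ln n / n)\<^sup>2 * exp (2 - 1.08 * ln n))) \<longlonglongrightarrow> 0"
    by real_asymp
  ultimately show ?thesis by (rule tendsto_0_le) simp
qed

text \<open>Evaluates a union bound over all nonempty vertex sets in which each vertex contributes a
  factor \<open>q\<close>.\<close>

lemma sum_power_card_nonempty:
  fixes q :: real
  assumes "finite V"
  shows "(\<Sum>U\<in>Pow V - {{}}. q ^ card U) = (1 + q) ^ card V - 1"
proof -
  have "(1 + q) ^ card V = (\<Prod>v\<in>V. q + 1)" by (simp add: add.commute)
  also have "\<dots> = (\<Sum>U\<in>Pow V. q ^ card U)"
    unfolding prod_add[OF assms] by simp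
  also have "\<dots> = 1 + (\<Sum>U\<in>Pow V - {{}}. q ^ card U)"
    using assms by (subst sum.remove[of _ "{}"]) auto
  finally show ?thesis by simp
qed

lemma card_all_edges_le:
  assumes "finite U"
  shows "real (card (all_edges U)) \<le> (card U)\<^sup>2 / 2"
  unfolding card_all_edges[OF assms] real_choose_two by (simp add: power2_eq_square mult_left_mono)

text \<open>The number \<open>4800\<close> makes \<open>ln L / 1600 = 3\<close> for \<open>L = exp 4800\<close>, and \<open>\<beta>\<close> is such that a set \<open>U\<close> is too
  dense with probability at most \<open>n powr (- 3 |U| + |U|)\<close>.\<close>

lemma prob_dense_set_tendsto:
  fixes \<beta> :: real
  defines "\<beta> \<equiv> 2 / (3 * (exp 4800 - 1))"
  shows "(\<lambda>n. measure_pmf.prob (random_graph_process n)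
    {Gs. \<exists>U\<in>Pow {..<n} - {{}}. card U \<le> \<beta> * n \<and>
       card U * (ln n / 100) / 16 \<le> card (edges (Gs ! upper_time n) \<inter> all_edges U)}) \<longlonglongrightarrow> 0"
proof -
  define L :: real where "L = exp 4800"
  have L: "L > 1" by (simp add: L_def)
  have "\<beta> = 2 / (3 * (L - 1))" by (simp add: \<beta>_def L_def)
  then have \<beta>: "(L - 1) * \<beta> = 2 / 3" using L by (simp add: divide_eq_eq algebra_simps)
  have "eventually (\<lambda>n. measure_pmf.prob (random_graph_process n)
    {Gs. \<exists>U\<in>Pow {..<n} - {{}}. card U \<le> \<beta> * n \<and>
       card U * (ln n / 100) / 16 \<le> card (edges (Gs ! upper_time n) \<inter> all_edges U)}
     \<le> (1 + exp (- 2 * ln n)) ^ n - 1) at_top"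
    using upper_time_ratio[of 1, OF zero_less_one] eventually_ge_at_top[of 2]
  proof eventually_elim
    case (elim n)
    let ?m = "upper_time n"
    have mN: "?m < n choose 2" using elim by auto
    then have N: "real (n choose 2) - ?m > 0" by simp
    have l: "ln (real n) > 0" using elim by simp
    have "real ?m / (real (n choose 2) - ?m) \<le> 3 * ln n / n"
      unfolding pos_divide_le_eq[OF N] using elim by blast
    then have ratio: "real n * (real ?m / (real (n choose 2) - ?m)) \<le> 3 * ln n"
      using elim by (simp add: field_simps)
    let ?P = "\<lambda>U Gs. card U \<le> \<beta> * n \<and> card U * (ln n / 100) / 16 \<le> card (edges (Gs ! ?m) \<inter> all_edges U)"
    have "measure_pmf.prob (random_graph_process n) {Gs. \<exists>U\<in>Pow {..<n} - {{}}. ?P U Gs}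
       \<le> (\<Sum>U\<in>Pow {..<n} - {{}}. exp (- 2 * ln n) ^ card U)"
    proof (rule prob_process_Ex_le)
      fix U assume U: "U \<in> Pow {..<n} - {{}}"
      then have finU: "finite U" by (auto intro: finite_subset)
      show "measure_pmf.prob (random_graph_process n) {Gs. ?P U Gs} \<le> exp (- 2 * ln n) ^ card U"
      proof (cases "card U \<le> \<beta> * n")
        case True
        have sub: "all_edges U \<subseteq> all_edges {..<n}" using U by (auto simp: all_edges_def)
        have "measure_pmf.prob (random_graph_process n) {Gs. ?P U Gs} \<le>
          measure_pmf.prob (random_graph_process n) {Gs. card U * (ln n / 100) / 16 \<le> card (edges (Gs ! ?m) \<inter> all_edges U)}"
          by (rule prob_process_mono) auto
        also have "\<dots> \<le> L powr (- (card U * (ln n / 100) / 16)) *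
            exp ((L - 1) * card (all_edges U) * ?m / (real (n choose 2) - ?m))"
          by (rule process_upper_tail[OF mN sub]) (use L in auto)
        also have "L powr (- (card U * (ln n / 100) / 16)) = exp (- 3 * (card U * ln n))"
          by (simp add: L_def powr_def)
        also have "exp ((L - 1) * card (all_edges U) * ?m / (real (n choose 2) - ?m)) \<le> exp (card U * ln n)"
        proof -
          have "real (card (all_edges U)) \<le> (card U)\<^sup>2 / 2" by (rule card_all_edges_le[OF finU])
          also have "\<dots> \<le> card U * (\<beta> * n) / 2"
            using mult_left_mono[OF True, of "card U"] by (simp add: power2_eq_square)
          finally have "(L - 1) * card (all_edges U) * (?m / (real (n choose 2) - ?m))
             \<le> (L - 1) * (card U * (\<beta> * n) / 2) * (?m / (real (n choose 2) - ?m))"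
            using L N by (intro mult_right_mono mult_left_mono) auto
          \<comment> \<open>The constants cancel: \<open>2 / 3\<close> from \<open>\<beta>\<close>,
            \<open>1 / 2\<close> from counting pairs and 3 from the edge ratio.\<close>
          also have "\<dots> = ((L - 1) * \<beta>) * (card U / 2) * (real n * (?m / (real (n choose 2) - ?m)))"
            by (simp add: mult_ac)
          also have "\<dots> \<le> ((L - 1) * \<beta>) * (card U / 2) * (3 * ln n)"
            by (intro mult_left_mono ratio) (simp add: \<beta>)
          also have "\<dots> = card U * ln n" by (simp add: \<beta>)
          finally show ?thesis by simp
        qed
        also have "exp (- 3 * (card U * ln n)) * exp (card U * ln n) = exp (- 2 * ln n) ^ card U"
          by (simp add: exp_of_nat_mult[symmetric] flip: exp_add)
        finally show ?thesis by simp
      qed simp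
    qed simp
    then show ?case by (simp add: sum_power_card_nonempty)
  qed
  \<comment> \<open>The base is \<open>1 + n powr (- 2)\<close>, so the difference is of order
    \<open>1 / n\<close>.\<close>
  moreover have "(\<lambda>n::nat. (1 + exp (- 2 * ln n)) ^ n - 1) \<longlonglongrightarrow> 0"
    by real_asymp
  ultimately show ?thesis by (rule tendsto_0_le) simp
qed

section \<open>Edge counts inside and across large vertex sets\<close>

lemma card_cut:
  assumes "finite A" "finite B" "A \<inter> B = {}"
  shows "card (cut A B) = card A * card B"
proof -
  have "cut A B = (\<lambda>(a, b). {a, b}) ` (A \<times> B)" by (auto simp: cut_def)
  moreover have "inj_on (\<lambda>(a, b). {a, b}) (A \<times> B)"
    using assms(3) by (auto simp: inj_on_def doubleton_eq_iff)
  ultimately show ?thesis by (simp add: card_image card_cartesian_product)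
qed

text \<open>The Chernoff exponents for deviations by a factor \<open>1 \<mp> \<gamma>\<close>.\<close>

lemma lower_exponent_pos:
  fixes \<gamma> :: real
  assumes "0 < \<gamma>" "\<gamma> < 1"
  shows "\<gamma> + (1 - \<gamma>) * ln (1 - \<gamma>) > 0"
proof -
  \<comment> \<open>The inequality \<open>ln y \<le> y - 1\<close> is strict here because equality
    forces \<open>y = 1\<close>.\<close>
  have "ln (1 / (1 - \<gamma>)) < 1 / (1 - \<gamma>) - 1"
    using assms ln_le_minus_one[of "1 / (1 - \<gamma>)"] ln_eq_minus_one[of "1 / (1 - \<gamma>)"]
    by (cases "ln (1 / (1 - \<gamma>)) = 1 / (1 - \<gamma>) - 1") (auto simp: field_simps)
  then have "(1 - \<gamma>) * ln (1 / (1 - \<gamma>)) < (1 - \<gamma>) * (1 / (1 - \<gamma>) - 1)"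
    using assms by (intro mult_strict_left_mono) auto
  moreover have "(1 - \<gamma>) * (1 / (1 - \<gamma>) - 1) = \<gamma>" using assms by (simp add: right_diff_distrib)
  moreover have "ln (1 / (1 - \<gamma>)) = - ln (1 - \<gamma>)" using assms by (simp add: ln_div)
  ultimately show ?thesis by simp
qed

lemma upper_exponent_pos:
  fixes \<gamma> :: real
  assumes "0 < \<gamma>"
  shows "(1 + \<gamma>) * ln (1 + \<gamma>) - \<gamma> > 0"
proof -
  have "ln (1 / (1 + \<gamma>)) < 1 / (1 + \<gamma>) - 1"
    using assms ln_le_minus_one[of "1 / (1 + \<gamma>)"] ln_eq_minus_one[of "1 / (1 + \<gamma>)"]
    by (cases "ln (1 / (1 + \<gamma>)) = 1 / (1 + \<gamma>) - 1") (auto simp: field_simps)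
  then have "(1 + \<gamma>) * ln (1 / (1 + \<gamma>)) < (1 + \<gamma>) * (1 / (1 + \<gamma>) - 1)"
    using assms by (intro mult_strict_left_mono) auto
  moreover have "(1 + \<gamma>) * (1 / (1 + \<gamma>) - 1) = - \<gamma>" using assms by (simp add: right_diff_distrib)
  moreover have "ln (1 / (1 + \<gamma>)) = - ln (1 + \<gamma>)" using assms by (simp add: ln_div)
  ultimately show ?thesis by simp
qed

text \<open>The lower tail with \<open>x = 1 - \<gamma>\<close>. Drawing without replacement weakens
  the ideal exponent \<open>c\<close> by at most \<open>m\<close> divided by the number of possible
  edges; the bound on \<open>m\<close> keeps half of \<open>c\<close>.\<close>

lemma process_lower_deviation:
  fixes \<gamma> :: real and n :: nat
  defines "c \<equiv> \<gamma> + (1 - \<gamma>) * ln (1 - \<gamma>)"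
  assumes \<gamma>: "0 < \<gamma>" "\<gamma> < 1" and mN: "m < n choose 2" and m: "m \<le> c / 2 * real (n choose 2)"
    and D: "D \<subseteq> all_edges {..<n}"
  shows "measure_pmf.prob (random_graph_process n)
      {Gs. card (edges (Gs ! m) \<inter> D) \<le> (1 - \<gamma>) * (real m * real (card D) / real (n choose 2))}
    \<le> exp (- (real m * real (card D) / real (n choose 2)) * (c / 2))"
proof -
  define N where "N = real (n choose 2)"
  define \<mu> where "\<mu> = real m * real (card D) / N"
  have N: "N > 0" using mN unfolding N_def by linarith
  have \<mu>: "\<mu> \<ge> 0" using N by (simp add: \<mu>_def)
  have "real m * card D \<le> N * card D" using mN by (intro mult_right_mono) (auto simp: N_def)
  then have "\<mu> \<le> card D" using N by (simp add: \<mu>_def field_simps)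
  then have s: "(1 - \<gamma>) * \<mu> \<le> card D" using \<gamma> \<mu> mult_left_le_one_le[of \<mu> "1 - \<gamma>"] by linarith
  have "measure_pmf.prob (random_graph_process n) {Gs. card (edges (Gs ! m) \<inter> D) \<le> (1 - \<gamma>) * \<mu>}
    \<le> (1 - \<gamma>) powr (- ((1 - \<gamma>) * \<mu>)) * exp (- (1 - (1 - \<gamma>)) * m * (card D - (1 - \<gamma>) * \<mu>) / N)"
    unfolding N_def by (rule process_lower_tail[OF mN D]) (use \<gamma> s in auto)
  also have "\<dots> = exp (- \<mu> * (c - \<gamma> * (1 - \<gamma>) * (m / N)))"
    using \<gamma> N by (simp add: powr_def \<mu>_def c_def field_simps flip: exp_add)
  also have "\<dots> \<le> exp (- \<mu> * (c / 2))"
  proof -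
    have "m / N \<le> c / 2" using m N by (simp add: N_def[symmetric] field_simps)
    moreover have "\<gamma> * (1 - \<gamma>) * (m / N) \<le> 1 * (m / N)"
      using \<gamma> N by (intro mult_right_mono mult_le_one) auto
    ultimately have "c / 2 \<le> c - \<gamma> * (1 - \<gamma>) * (m / N)" by linarith
    then have "\<mu> * (c / 2) \<le> \<mu> * (c - \<gamma> * (1 - \<gamma>) * (m / N))" by (rule mult_left_mono[OF _ \<mu>])
    then show ?thesis by simp
  qed
  finally show ?thesis by (simp add: \<mu>_def N_def)
qed

text \<open>The upper tail with \<open>L = 1 + \<gamma>\<close>. The number of missing edges can
  shrink by \<open>m\<close>, which again costs at most half of \<open>c\<close>. Replacing
  \<open>card F\<close> by a bound \<open>M\<close> lets the caller control the deviation through a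
  lower bound on \<open>M\<close>.\<close>

lemma process_upper_deviation:
  fixes \<gamma> M :: real and n :: nat
  defines "c \<equiv> (1 + \<gamma>) * ln (1 + \<gamma>) - \<gamma>"
  assumes \<gamma>: "0 < \<gamma>" "\<gamma> < 1" and mN: "m < n choose 2" and m: "m \<le> c / 2 * (real (n choose 2) - m)"
    and F: "F \<subseteq> all_edges {..<n}" and M: "card F \<le> M"
  shows "measure_pmf.prob (random_graph_process n)
      {Gs. (1 + \<gamma>) * (m * M / real (n choose 2)) \<le> card (edges (Gs ! m) \<inter> F)}
    \<le> exp (- (m * M / real (n choose 2)) * (c / 2))"
proof -
  define N where "N = real (n choose 2)"
  define \<mu> where "\<mu> = m * M / N"
  have N: "N - m > 0" "N > 0" using mN unfolding N_def by linarith+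
  have \<mu>: "\<mu> \<ge> 0" using N M by (simp add: \<mu>_def)
  have "measure_pmf.prob (random_graph_process n) {Gs. (1 + \<gamma>) * \<mu> \<le> card (edges (Gs ! m) \<inter> F)}
    \<le> (1 + \<gamma>) powr (- ((1 + \<gamma>) * \<mu>)) * exp ((1 + \<gamma> - 1) * card F * m / (N - m))"
    unfolding N_def by (rule process_upper_tail[OF mN F]) (use \<gamma> in auto)
  also have "\<dots> \<le> (1 + \<gamma>) powr (- ((1 + \<gamma>) * \<mu>)) * exp (\<mu> * (\<gamma> + c / 2))"
  proof -
    have "(1 + \<gamma> - 1) * card F * m / (N - m) \<le> \<gamma> * M * m / (N - m)"
      using \<gamma> M N by (intro divide_right_mono mult_right_mono) auto
    also have "\<dots> = \<mu> * (\<gamma> * (1 + m / (N - m)))"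
      using N by (simp add: \<mu>_def field_simps)
    also have "\<dots> \<le> \<mu> * (\<gamma> + c / 2)"
    proof (rule mult_left_mono[OF _ \<mu>])
      have "m / (N - m) \<le> c / 2" using m N by (simp add: N_def[symmetric] field_simps)
      moreover have "\<gamma> * (m / (N - m)) \<le> 1 * (m / (N - m))" using \<gamma> N by (intro mult_right_mono) auto
      moreover have "\<gamma> * (1 + m / (N - m)) = \<gamma> + \<gamma> * (m / (N - m))" by (simp add: distrib_left)
      ultimately show "\<gamma> * (1 + m / (N - m)) \<le> \<gamma> + c / 2" by linarith
    qed
    finally show ?thesis by (intro mult_left_mono) auto
  qed
  also have "\<dots> = exp (- \<mu> * (c / 2))"
    using \<gamma> by (simp add: powr_def c_def field_simps flip: exp_add)
  finally show ?thesis by (simp add: \<mu>_def N_def)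
qed

text \<open>Linear-sized sets have means of order \<open>n * ln n\<close>, so each set and time
  fails with probability \<open>exp (- C * (3 / 8 * real n * ln n - 1))\<close> up to a factor 2.
  This beats the union bound over \<open>2 ^ n\<close> sets and all times in the window.\<close>

lemma prob_unbalanced_tendsto:
  fixes \<epsilon> \<beta> :: real and k :: nat
  assumes eps: "0 < \<epsilon>" "\<epsilon> \<le> 1 / 2" and \<beta>: "0 < \<beta>"
  shows "(\<lambda>n. measure_pmf.prob (random_graph_process n)
    {Gs. \<exists>(A, m)\<in>Pow {..<n} \<times> {lower_time n..upper_time n}. 2 * card A \<le> n \<and> card A + k > \<beta> * n \<and>
       \<not> (2 * real (card (edges (Gs ! m) \<inter> all_edges A)) \<le> (1 + \<epsilon>) * card (edges (Gs ! m) \<inter> cut A ({..<n} - A)) \<and>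
          card (edges (Gs ! m) \<inter> cut A ({..<n} - A)) > k * n / \<epsilon>)}) \<longlonglongrightarrow> 0"
proof -
  define \<gamma> where "\<gamma> = \<epsilon> / 4"
  have \<gamma>: "0 < \<gamma>" "\<gamma> < 1 / 2" using eps by (auto simp: \<gamma>_def)
  define c1 where "c1 = \<gamma> + (1 - \<gamma>) * ln (1 - \<gamma>)"
  define c2 where "c2 = (1 + \<gamma>) * ln (1 + \<gamma>) - \<gamma>"
  have c12: "c1 > 0" "c2 > 0"
    unfolding c1_def c2_def using lower_exponent_pos[of \<gamma>] upper_exponent_pos[of \<gamma>] \<gamma> by auto
  define c where "c = min c1 c2"
  have c: "c > 0" "c \<le> c1" "c \<le> c2" using c12 by (auto simp: c_def)
  \<comment> \<open>For \<open>a \<ge> \<beta> * n / 2\<close> the two terms bound from below, as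
    multiples of \<open>n\<^sup>2\<close>, the number \<open>a * (n - a)\<close> of pairs across and
    the quantity \<open>a\<^sup>2 / 2\<close> for pairs inside.\<close>
  define \<kappa> where "\<kappa> = min (\<beta> / 4) (\<beta>\<^sup>2 / 8)"
  have \<kappa>: "\<kappa> > 0" "\<kappa> \<le> \<beta> / 4" "\<kappa> \<le> \<beta>\<^sup>2 / 8" using \<beta> by (auto simp: \<kappa>_def)
  define C where "C = \<kappa> * c"
  have C: "C > 0" using \<kappa> c by (simp add: C_def)
  let ?U = "\<lambda>n A m Gs. 2 * card A \<le> n \<and> card A + k > \<beta> * n \<and>
       \<not> (2 * real (card (edges (Gs ! m) \<inter> all_edges A)) \<le> (1 + \<epsilon>) * card (edges (Gs ! m) \<inter> cut A ({..<n} - A)) \<and>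
          card (edges (Gs ! m) \<inter> cut A ({..<n} - A)) > k * n / \<epsilon>)"
  have "eventually (\<lambda>n. real n * ln n + 1 \<le> c2 / 2 * (real n * (real n - 1) / 2 - (real n * ln n + 1))) at_top"
    using c12 by real_asymp
  moreover have "eventually (\<lambda>n. \<kappa> * (3 / 8 * real n * ln n - 1) \<ge> k * n / \<epsilon>) at_top"
    using \<kappa> eps by real_asymp
  moreover have "eventually (\<lambda>n::nat. real k \<le> \<beta> * n / 2) at_top"
    using \<beta> by real_asymp
  moreover have "eventually (\<lambda>n. upper_time n < n choose 2 \<and>
    real (upper_time n) \<le> c1 / 2 * real (n choose 2) \<and>
    real (upper_time n) \<le> 3 * ln n / n * (real (n choose 2) - upper_time n)) at_top"
    by (rule upper_time_ratio) (use c12 in simp)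
  ultimately have "eventually (\<lambda>n. measure_pmf.prob (random_graph_process n)
    {Gs. \<exists>p\<in>Pow {..<n} \<times> {lower_time n..upper_time n}. case p of (A, m) \<Rightarrow> ?U n A m Gs}
    \<le> 2 ^ n * (real n * ln n + 2) * (2 * exp (- C * (3 / 8 * real n * ln n - 1)))) at_top"
    using eventually_ge_at_top[of 2]
  proof eventually_elim
    case (elim n)
    let ?m1 = "lower_time n" and ?m2 = "upper_time n"
    define N where "N = real (n choose 2)"
    have m2N: "?m2 < n choose 2" using elim by auto
    have N0: "N > 0" using m2N unfolding N_def by linarith
    have N2: "N \<le> real n * real n / 2" unfolding N_def real_choose_two by (simp add: mult_left_mono)
    have c2N: "?m2 \<le> c2 / 2 * (N - ?m2)"
    proof -
      have "c2 / 2 * (real n * (real n - 1) / 2 - (real n * ln n + 1)) \<le> c2 / 2 * (N - ?m2)"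
        using c12 upper_time_bounds[of n] unfolding N_def real_choose_two by (intro mult_left_mono) auto
      then show ?thesis using elim upper_time_bounds[of n] by linarith
    qed
    have l: "ln (real n) \<ge> 0" using elim by simp
    define e where "e = exp (- C * (3 / 8 * real n * ln n - 1))"
    have "measure_pmf.prob (random_graph_process n)
        {Gs. \<exists>p\<in>Pow {..<n} \<times> {?m1..?m2}. case p of (A, m) \<Rightarrow> ?U n A m Gs}
        \<le> (\<Sum>p\<in>Pow {..<n} \<times> {?m1..?m2}. 2 * e)"
    proof (rule prob_process_Ex_le)
      fix p assume "p \<in> Pow {..<n} \<times> {?m1..?m2}"
      then obtain A m where p: "p = (A, m)" and A: "A \<subseteq> {..<n}" and m: "?m1 \<le> m" "m \<le> ?m2" by auto
      have "measure_pmf.prob (random_graph_process n) {Gs. ?U n A m Gs} \<le> 2 * e"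
      proof (cases "2 * card A \<le> n \<and> card A + k > \<beta> * n")
        case True
        have finA: "finite A" using A by (rule finite_subset) simp
        define a where "a = real (card A)"
        have a: "\<beta> * n / 2 \<le> a" "a \<le> real n - a" "0 \<le> a" "real n / 2 \<le> real n - a"
          using True elim by (auto simp: a_def)
        let ?D = "cut A ({..<n} - A)"
        have "card ({..<n} - A) = n - card A"
          using card_Diff_subset[OF finA A] by simp
        then have cD: "real (card ?D) = a * (real n - a)"
          using card_cut[OF finA, of "{..<n} - A"] True by (simp add: a_def of_nat_diff)
        have D: "?D \<subseteq> all_edges {..<n}" using A by (auto simp: cut_def all_edges_def card_2_iff)
        have F: "all_edges A \<subseteq> all_edges {..<n}" using A by (auto simp: all_edges_def)
        have cF: "card (all_edges A) \<le> a\<^sup>2 / 2" using card_all_edges_le[OF finA] by (simp add: a_def)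
        have mN: "m < n choose 2" using m m2N by simp
        \<comment> \<open>The mean number of cut edges, and an upper bound for the mean number of
          internal edges; \<open>2 * \<mu>2 \<le> \<mu>1\<close> because \<open>a\<close> is at most
          \<open>n - a\<close>.\<close>
        define \<mu>1 where "\<mu>1 = real m * real (card ?D) / N"
        define \<mu>2 where "\<mu>2 = m * (a\<^sup>2 / 2) / N"
        have mu_aux: "2 * (\<kappa> * (3 / 8 * real n * ln n - 1)) \<le> m * X / N" if X: "\<kappa> * (real n * real n) \<le> X" for X :: real
        proof -
          have "0 \<le> \<kappa> * (real n * real n)" using \<kappa> by simp
          then have X0: "0 \<le> X" using X by linarith
          have "2 * (\<kappa> * (3 / 8 * real n * ln n - 1)) \<le> 2 * (\<kappa> * m)"
            using lower_time_bounds[of n] m \<kappa> by (intro mult_left_mono) auto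
          also have "\<dots> = m * (\<kappa> * (real n * real n)) / (real n * real n / 2)"
            using elim by simp
          also have "\<dots> \<le> m * X / N"
            using X0 N0 N2 by (intro frac_le mult_left_mono[OF X]) auto
          finally show ?thesis .
        qed
        have \<mu>1: "2 * (\<kappa> * (3 / 8 * real n * ln n - 1)) \<le> \<mu>1"
          unfolding \<mu>1_def
        proof (rule mu_aux)
          have "\<kappa> * (real n * real n) \<le> \<beta> / 4 * (real n * real n)"
            using \<kappa> by (intro mult_right_mono) auto
          also have "\<dots> = (\<beta> * n / 2) * (real n / 2)" by simp
          also have "\<dots> \<le> a * (real n - a)" using a \<beta> by (intro mult_mono) auto
          finally show "\<kappa> * (real n * real n) \<le> real (card ?D)" unfolding cD .
        qed
        have \<mu>2: "2 * (\<kappa> * (3 / 8 * real n * ln n - 1)) \<le> \<mu>2"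
          unfolding \<mu>2_def
        proof (rule mu_aux)
          have "\<kappa> * (real n * real n) \<le> \<beta>\<^sup>2 / 8 * (real n * real n)"
            using \<kappa> by (intro mult_right_mono) auto
          also have "\<dots> = (\<beta> * n / 2)\<^sup>2 / 2" by (simp add: power2_eq_square)
          also have "\<dots> \<le> a\<^sup>2 / 2" using a \<beta> by (intro divide_right_mono power_mono) auto
          finally show "\<kappa> * (real n * real n) \<le> a\<^sup>2 / 2" .
        qed
        have e_aux: "exp (- \<mu> * (c' / 2)) \<le> e"
          if \<mu>: "2 * (\<kappa> * (3 / 8 * real n * ln n - 1)) \<le> \<mu>" and c': "c \<le> c'" for \<mu> c'
        proof -
          have pos: "0 \<le> \<kappa> * (3 / 8 * real n * ln n - 1)" using elim eps by (meson divide_nonneg_pos mult_nonneg_nonneg of_nat_0_le_iff order_trans)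
          have "C * (3 / 8 * real n * ln n - 1) = 2 * (\<kappa> * (3 / 8 * real n * ln n - 1)) * (c / 2)"
            by (simp add: C_def)
          also have "\<dots> \<le> \<mu> * (c' / 2)" using \<mu> c' c pos by (intro mult_mono) auto
          finally show ?thesis by (simp add: e_def)
        qed
        let ?low = "{Gs. card (edges (Gs ! m) \<inter> ?D) \<le> (1 - \<gamma>) * \<mu>1}"
        let ?high = "{Gs. (1 + \<gamma>) * \<mu>2 \<le> card (edges (Gs ! m) \<inter> all_edges A)}"
        have "measure_pmf.prob (random_graph_process n) ?low \<le> exp (- \<mu>1 * (c1 / 2))"
          unfolding \<mu>1_def N_def c1_def
          by (rule process_lower_deviation[OF _ _ mN _ D]) (use \<gamma> m elim in \<open>auto simp: c1_def[symmetric]\<close>)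
        then have low: "measure_pmf.prob (random_graph_process n) ?low \<le> e"
          using e_aux[OF \<mu>1 c(2)] by linarith
        have "measure_pmf.prob (random_graph_process n) ?high \<le> exp (- \<mu>2 * (c2 / 2))"
          unfolding \<mu>2_def N_def c2_def
        proof (rule process_upper_deviation[OF _ _ mN _ F cF])
          have "c2 / 2 * (N - ?m2) \<le> c2 / 2 * (N - m)" using m c12 by (intro mult_left_mono) auto
          then show "real m \<le> ((1 + \<gamma>) * ln (1 + \<gamma>) - \<gamma>) / 2 * (real (n choose 2) - real m)"
            using c2N m unfolding c2_def[symmetric] N_def[symmetric] by linarith
        qed (use \<gamma> in auto)
        then have high: "measure_pmf.prob (random_graph_process n) ?high \<le> e"
          using e_aux[OF \<mu>2 c(3)] by linarith
        have "measure_pmf.prob (random_graph_process n) {Gs. ?U n A m Gs}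
          \<le> measure_pmf.prob (random_graph_process n) (?low \<union> ?high)"
        proof (intro measure_pmf.finite_measure_mono subsetI)
          fix Gs assume "Gs \<in> {Gs. ?U n A m Gs}"
          then have U: "?U n A m Gs" by simp
          show "Gs \<in> ?low \<union> ?high"
          proof (rule ccontr)
            assume "\<not> ?thesis"
            then have lo: "card (edges (Gs ! m) \<inter> ?D) > (1 - \<gamma>) * \<mu>1"
              and hi: "card (edges (Gs ! m) \<inter> all_edges A) < (1 + \<gamma>) * \<mu>2" by auto
            have pos: "0 \<le> \<mu>1" using N0 by (simp add: \<mu>1_def)
            have "2 * \<mu>2 = m * (a * a) / N" by (simp add: \<mu>2_def power2_eq_square)
            also have "\<dots> \<le> \<mu>1"
              unfolding \<mu>1_def cD using a N0 by (intro divide_right_mono mult_left_mono) auto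
            finally have "(1 + \<gamma>) * (2 * \<mu>2) \<le> (1 + \<gamma>) * \<mu>1" using \<gamma> by (intro mult_left_mono) auto
            also have "\<dots> \<le> (1 + \<epsilon>) * ((1 - \<gamma>) * \<mu>1)"
            proof -
              \<comment> \<open>The reason for \<open>\<gamma> = \<epsilon> / 4\<close>: upward and
                downward deviations together stay within the factor
                \<open>1 + \<epsilon>\<close>.\<close>
              have "1 + \<gamma> \<le> (1 + \<epsilon>) * (1 - \<gamma>)"
              proof -
                have "\<epsilon> * \<epsilon> \<le> \<epsilon> * (1 / 2)" using eps by (intro mult_left_mono) auto
                then have "\<epsilon> * \<epsilon> \<le> 2 * \<epsilon>" using eps by simp
                then show ?thesis by (simp add: \<gamma>_def field_simps)
              qed
              then show ?thesis using mult_right_mono[OF _ pos] by (metis mult.assoc)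
            qed
            also have "\<dots> \<le> (1 + \<epsilon>) * card (edges (Gs ! m) \<inter> ?D)"
              using lo eps by (intro mult_left_mono) auto
            finally have "2 * real (card (edges (Gs ! m) \<inter> all_edges A)) \<le> (1 + \<epsilon>) * card (edges (Gs ! m) \<inter> ?D)"
              using hi by linarith
            moreover have "k * n / \<epsilon> < card (edges (Gs ! m) \<inter> ?D)"
            proof -
              \<comment> \<open>The cut mean is of order \<open>n * ln n\<close>, which eventually
                exceeds any linear function of \<open>n\<close>.\<close>
              have "k * n / \<epsilon> \<le> 1 / 2 * \<mu>1" using elim \<mu>1 by linarith
              also have "\<dots> \<le> (1 - \<gamma>) * \<mu>1" using \<gamma> pos by (intro mult_right_mono) auto
              finally show ?thesis using lo by linarith
            qed
            ultimately show False using U by simp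
          qed
        qed simp
        also have "\<dots> \<le> 2 * e"
          using measure_Un_le[of ?low "measure_pmf (random_graph_process n)" ?high] low high by simp
        finally show ?thesis .
      next
        case False
        then have "{Gs. ?U n A m Gs} = {}" by blast
        then show ?thesis by (simp only: measure_empty) (simp add: e_def)
      qed
      then show "measure_pmf.prob (random_graph_process n) {Gs. case p of (A, m) \<Rightarrow> ?U n A m Gs} \<le> 2 * e"
        by (simp add: p)
    qed simp
    also have "\<dots> = 2 ^ n * real (Suc ?m2 - ?m1) * (2 * e)"
      by (simp add: card_cartesian_product card_Pow)
    also have "\<dots> \<le> 2 ^ n * (real n * ln n + 2) * (2 * e)"
    proof (intro mult_right_mono mult_left_mono)
      have "real (Suc ?m2 - ?m1) \<le> real (Suc ?m2)" by simp
      then show "real (Suc ?m2 - ?m1) \<le> real n * ln n + 2" using upper_time_bounds[of n] by simp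
    qed (auto simp: e_def)
    finally show ?case by (simp add: e_def)
  qed
  moreover have "(\<lambda>n::nat. 2 ^ n * (real n * ln n + 2) * (2 * exp (- C * (3 / 8 * real n * ln n - 1)))) \<longlonglongrightarrow> 0"
    using C by real_asymp
  ultimately have "(\<lambda>n. measure_pmf.prob (random_graph_process n)
    {Gs. \<exists>p\<in>Pow {..<n} \<times> {lower_time n..upper_time n}. case p of (A, m) \<Rightarrow> ?U n A m Gs}) \<longlonglongrightarrow> 0"
    by (rule tendsto_0_le) simp
  then show ?thesis by simp
qed

section \<open>Resilience at the hitting time\<close>

lemma resilient_antimono:
  assumes "resilient \<alpha> k P G" "\<alpha>' \<le> \<alpha>"
  shows "resilient \<alpha>' k P G"
proof -
  have "\<alpha>' * real (deg G v) \<le> \<alpha> * real (deg G v)" for v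
    using assms(2) by (rule mult_right_mono) simp
  then show ?thesis using assms(1) unfolding resilient_def by (meson order_trans)
qed

lemma deg_mono: "finite (edges G') \<Longrightarrow> edges G \<subseteq> edges G' \<Longrightarrow> deg G v \<le> deg G' v"
  unfolding deg_def by (rule card_mono) auto

text \<open>Degrees only grow, so a vertex isolated at \<open>m1\<close> blocks every step up to
  \<open>m1\<close>. The step \<open>m2\<close> qualifies, so the \<open>LEAST\<close> in
  \<open>hitting_time\<close> is attained.\<close>

lemma hitting_time_between:
  assumes t: "trajectory n (n choose 2) Gs" and n: "n > 0" and k: "k > 0" and m: "m1 \<le> n choose 2" "m2 \<le> n choose 2"
    and iso: "\<exists>v<n. deg (Gs ! m1) v = 0" and min: "\<forall>v<n. k \<le> deg (Gs ! m2) v"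
  shows "m1 < hitting_time k Gs" "hitting_time k Gs \<le> m2"
proof -
  have len: "length Gs = Suc (n choose 2)" and V: "\<And>j. j \<le> n choose 2 \<Longrightarrow> verts (Gs ! j) = {..<n}"
    and sub: "\<And>j. j \<le> n choose 2 \<Longrightarrow> edges (Gs ! j) \<subseteq> all_edges {..<n}"
    and mono: "\<And>i j. i \<le> j \<Longrightarrow> j \<le> n choose 2 \<Longrightarrow> edges (Gs ! i) \<subseteq> edges (Gs ! j)"
    using t by (auto simp: trajectory_def)
  have min_iff: "k \<le> min_degree (Gs ! j) \<longleftrightarrow> (\<forall>v<n. k \<le> deg (Gs ! j) v)" if "j \<le> n choose 2" for j
    unfolding min_degree_def V[OF that] using n by (subst Min_ge_iff) auto
  let ?Q = "\<lambda>m. m < length Gs \<and> k \<le> min_degree (Gs ! m)"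
  have Q: "?Q m2" using min m min_iff len by simp
  then have \<tau>: "?Q (hitting_time k Gs)" unfolding hitting_time_def by (rule LeastI)
  show "hitting_time k Gs \<le> m2" unfolding hitting_time_def using Q by (rule Least_le)
  then have \<tau>_le: "hitting_time k Gs \<le> n choose 2" using m by simp
  show "m1 < hitting_time k Gs"
  proof (rule ccontr)
    assume le: "\<not> ?thesis"
    obtain v where v: "v < n" "deg (Gs ! m1) v = 0" using iso by blast
    have k\<tau>: "k \<le> deg (Gs ! hitting_time k Gs) v" using \<tau> min_iff[OF \<tau>_le] v by simp
    have "finite (edges (Gs ! m1))"
      using sub[OF m(1)] by (rule finite_subset) (simp add: finite_all_edges)
    then have "deg (Gs ! hitting_time k Gs) v \<le> deg (Gs ! m1) v"
      using le m(1) by (intro deg_mono mono) auto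
    then show False using k\<tau> v k by simp
  qed
qed

lemma prob_disj_le:
  "measure_pmf.prob p {x. P x \<or> Q x} \<le> measure_pmf.prob p {x. P x} + measure_pmf.prob p {x. Q x}"
  using measure_Un_le[of "{x. P x}" "measure_pmf p" "{x. Q x}"] by (simp add: Collect_disj_eq)

text \<open>Six bad events cover failure. A vertex small at the hitting time was small at the lower
  time, and its edges persist to the upper time, so \<open>B3\<close>, \<open>B4\<close> and
  \<open>B5\<close> transfer by monotonicity. Balance of cuts is not monotone; \<open>B6\<close>
  therefore ranges over all times of the window.\<close>

lemma resilient_prob_tendsto:
  fixes k :: nat and \<epsilon> :: real
  assumes k: "k \<ge> 1" and eps: "0 < \<epsilon>" "\<epsilon> \<le> 1 / 2"
  shows "(\<lambda>n. measure_pmf.prob (random_graph_process n)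
            {Gs. resilient (1 / 2 - \<epsilon>) k (k_connected k) (Gs ! hitting_time k Gs)}) \<longlonglongrightarrow> 1"
proof -
  define \<beta> :: real where "\<beta> = 2 / (3 * (exp 4800 - 1))"
  have \<beta>: "\<beta> > 0" by (simp add: \<beta>_def)
  define B1 where "B1 n Gs \<longleftrightarrow> (\<forall>v<n. deg (Gs ! lower_time n) v \<noteq> 0)" for n and Gs :: "nat ugraph list"
  define B2 where "B2 n Gs \<longleftrightarrow> (\<exists>v\<in>{..<n}. deg (Gs ! upper_time n) v < k)" for n and Gs :: "nat ugraph list"
  define B3 where "B3 n Gs \<longleftrightarrow> (\<exists>(u, v)\<in>{..<n} \<times> {..<n}. u \<noteq> v \<and>
     deg (Gs ! lower_time n) u \<le> ln n / 100 \<and> deg (Gs ! lower_time n) v \<le> ln n / 100 \<and>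
     {u, v} \<in> edges (Gs ! upper_time n))" for n and Gs :: "nat ugraph list"
  define B4 where "B4 n Gs \<longleftrightarrow> (\<exists>(u, v, w)\<in>{..<n} \<times> {..<n} \<times> {..<n}. u \<noteq> v \<and>
     deg (Gs ! lower_time n) u \<le> ln n / 100 \<and> deg (Gs ! lower_time n) v \<le> ln n / 100 \<and>
     {u, w} \<in> edges (Gs ! upper_time n) \<and> {v, w} \<in> edges (Gs ! upper_time n))" for n and Gs :: "nat ugraph list"
  define B5 where "B5 n Gs \<longleftrightarrow> (\<exists>U\<in>Pow {..<n} - {{}}. card U \<le> \<beta> * n \<and>
       card U * (ln n / 100) / 16 \<le> card (edges (Gs ! upper_time n) \<inter> all_edges U))" for n and Gs :: "nat ugraph list"
  define B6 where "B6 n Gs \<longleftrightarrow> (\<exists>(A, m)\<in>Pow {..<n} \<times> {lower_time n..upper_time n}. 2 * card A \<le> n \<and> card A + k > \<beta> * n \<and>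
       \<not> (2 * real (card (edges (Gs ! m) \<inter> all_edges A)) \<le> (1 + \<epsilon>) * card (edges (Gs ! m) \<inter> cut A ({..<n} - A)) \<and>
          card (edges (Gs ! m) \<inter> cut A ({..<n} - A)) > k * n / \<epsilon>))" for n and Gs :: "nat ugraph list"
  define good where "good Gs \<longleftrightarrow> resilient (1 / 2 - \<epsilon>) k (k_connected k) (Gs ! hitting_time k Gs)"
    for Gs :: "nat ugraph list"
  let ?p = "\<lambda>n B. measure_pmf.prob (random_graph_process n) {Gs. B n Gs}"
  have lim: "(\<lambda>n. ?p n B1 + ?p n B2 + ?p n B3 + ?p n B4 + ?p n B5 + ?p n B6) \<longlonglongrightarrow> 0"
  proof (intro tendsto_add_zero)
    show "(\<lambda>n. ?p n B1) \<longlonglongrightarrow> 0" unfolding B1_def by (rule prob_no_isolated_tendsto)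
    show "(\<lambda>n. ?p n B2) \<longlonglongrightarrow> 0" unfolding B2_def by (rule prob_low_degree_tendsto)
    show "(\<lambda>n. ?p n B3) \<longlonglongrightarrow> 0" unfolding B3_def by (rule prob_low_degree_adjacent_tendsto)
    show "(\<lambda>n. ?p n B4) \<longlonglongrightarrow> 0" unfolding B4_def by (rule prob_low_degree_path_tendsto)
    show "(\<lambda>n. ?p n B5) \<longlonglongrightarrow> 0" unfolding B5_def \<beta>_def by (rule prob_dense_set_tendsto)
    show "(\<lambda>n. ?p n B6) \<longlonglongrightarrow> 0" unfolding B6_def by (rule prob_unbalanced_tendsto[OF eps \<beta>])
  qed
  have "eventually (\<lambda>n. ln (real n) / 100 \<ge> 8 * k) at_top" by real_asymp
  then have "eventually (\<lambda>n. 1 - (?p n B1 + ?p n B2 + ?p n B3 + ?p n B4 + ?p n B5 + ?p n B6) \<le>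
     measure_pmf.prob (random_graph_process n) {Gs. good Gs}) at_top"
    using upper_time_ratio[of 1, OF zero_less_one] eventually_ge_at_top[of 2]
  proof eventually_elim
    case (elim n)
    let ?m1 = "lower_time n" and ?m2 = "upper_time n"
    have m2: "?m2 \<le> n choose 2" using elim by simp
    have m1: "?m1 \<le> n choose 2" using m2 lower_le_upper_time[of n] by simp
    have good: "good Gs" if t: "trajectory n (n choose 2) Gs"
      and B: "\<not> (B1 n Gs \<or> B2 n Gs \<or> B3 n Gs \<or> B4 n Gs \<or> B5 n Gs \<or> B6 n Gs)" for Gs
    proof -
      define \<tau> where "\<tau> = hitting_time k Gs"
      have iso: "\<exists>v<n. deg (Gs ! ?m1) v = 0" using B by (simp add: B1_def)
      have min: "\<forall>v<n. k \<le> deg (Gs ! ?m2) v" using B by (auto simp: B2_def not_less)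
      have "?m1 < \<tau>" "\<tau> \<le> ?m2"
        using hitting_time_between[OF t _ _ m1 m2 iso min] k elim by (auto simp: \<tau>_def)
      then have \<tau>: "?m1 \<le> \<tau>" "\<tau> \<le> ?m2" "\<tau> \<le> n choose 2" using m2 by auto
      have V: "verts (Gs ! \<tau>) = {..<n}" and sub: "edges (Gs ! \<tau>) \<subseteq> all_edges {..<n}"
        and le: "edges (Gs ! \<tau>) \<subseteq> edges (Gs ! ?m2)" and ge: "edges (Gs ! ?m1) \<subseteq> edges (Gs ! \<tau>)"
        using t \<tau> m2 by (auto simp: trajectory_def)
      have simp_G: "simple_graph (Gs ! \<tau>)" using V sub by (simp add: simple_graph_def)
      have edge: "a < n" "b < n" "a \<noteq> b" if "{a, b} \<in> edges (Gs ! \<tau>)" for a b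
        using sub that by (auto simp: all_edges_def split: if_splits)
      have deg_le: "deg (Gs ! ?m1) v \<le> deg (Gs ! \<tau>) v" for v
        by (rule deg_mono[OF finite_edges[OF simp_G] ge])
      have fin2: "finite (edges (Gs ! ?m2))" by (rule trajectory_deg(2)[OF t m2])
      show ?thesis unfolding good_def \<tau>_def[symmetric]
      proof (rule resilient_of_pseudorandom[OF simp_G eps k, where s = "ln n / 100" and b = "\<beta> * n"])
        fix u v assume uv: "{u, v} \<in> edges (Gs ! \<tau>)"
        then have "\<not> (deg (Gs ! ?m1) u \<le> ln n / 100 \<and> deg (Gs ! ?m1) v \<le> ln n / 100)"
          using B edge[OF uv] le unfolding B3_def by blast
        then show "deg (Gs ! \<tau>) u > ln n / 100 \<or> deg (Gs ! \<tau>) v > ln n / 100"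
          using deg_le[of u] deg_le[of v] by linarith
      next
        fix u v w assume uv: "u \<noteq> v" "{u, w} \<in> edges (Gs ! \<tau>)" "{v, w} \<in> edges (Gs ! \<tau>)"
        then have "\<not> (deg (Gs ! ?m1) u \<le> ln n / 100 \<and> deg (Gs ! ?m1) v \<le> ln n / 100)"
          using B edge[OF uv(2)] edge[OF uv(3)] le unfolding B4_def by blast
        then show "deg (Gs ! \<tau>) u > ln n / 100 \<or> deg (Gs ! \<tau>) v > ln n / 100"
          using deg_le[of u] deg_le[of v] by linarith
      next
        fix U assume U: "U \<subseteq> verts (Gs ! \<tau>)" "U \<noteq> {}" "card U \<le> \<beta> * n"
        have "card (edges (Gs ! \<tau>) \<inter> all_edges U) \<le> card (edges (Gs ! ?m2) \<inter> all_edges U)"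
          using le fin2 by (intro card_mono) auto
        moreover have "card (edges (Gs ! ?m2) \<inter> all_edges U) < card U * (ln n / 100) / 16"
        proof -
          have "U \<in> Pow {..<n} - {{}}" using U V by auto
          then show ?thesis using B U(3) unfolding B5_def by (meson not_le)
        qed
        ultimately show "card (edges (Gs ! \<tau>) \<inter> all_edges U) < card U * (ln n / 100) / 16" by linarith
      next
        fix A assume A: "A \<subseteq> verts (Gs ! \<tau>)" "2 * card A \<le> card (verts (Gs ! \<tau>))" "card A + k > \<beta> * n"
        then have "(A, \<tau>) \<in> Pow {..<n} \<times> {?m1..?m2}" using V \<tau> by auto
        then show "2 * real (card (edges (Gs ! \<tau>) \<inter> all_edges A)) \<le> (1 + \<epsilon>) * card (edges (Gs ! \<tau>) \<inter> cut A (verts (Gs ! \<tau>) - A)) \<and>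
          card (edges (Gs ! \<tau>) \<inter> cut A (verts (Gs ! \<tau>) - A)) > k * card (verts (Gs ! \<tau>)) / \<epsilon>"
          using B A unfolding B6_def V by auto
      qed (use elim in simp)
    qed
    have "1 - measure_pmf.prob (random_graph_process n) {Gs. good Gs} = measure_pmf.prob (random_graph_process n) {Gs. \<not> good Gs}"
      using measure_pmf.prob_compl[of "{Gs. good Gs}" "random_graph_process n"] by (simp add: Collect_neg_eq Compl_eq_Diff_UNIV)
    also have "\<dots> \<le> measure_pmf.prob (random_graph_process n)
        {Gs. B1 n Gs \<or> B2 n Gs \<or> B3 n Gs \<or> B4 n Gs \<or> B5 n Gs \<or> B6 n Gs}"
      by (rule prob_process_mono) (use good in auto)
    also have "\<dots> \<le> ?p n B1 + ?p n B2 + ?p n B3 + ?p n B4 + ?p n B5 + ?p n B6"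
      unfolding add.assoc by (intro order_trans[OF prob_disj_le] add_left_mono order_refl)
    finally show ?case by linarith
  qed
  then have "(\<lambda>n. measure_pmf.prob (random_graph_process n) {Gs. good Gs}) \<longlonglongrightarrow> 1"
  proof (rule tendsto_sandwich)
    show "(\<lambda>n. 1 - (?p n B1 + ?p n B2 + ?p n B3 + ?p n B4 + ?p n B5 + ?p n B6)) \<longlonglongrightarrow> 1"
      using tendsto_diff[OF tendsto_const lim, of 1] by simp
  qed (auto intro: tendsto_const)
  then show ?thesis by (simp add: good_def)
qed

theorem theorem1p6:
  fixes k :: nat and \<epsilon> :: real
  assumes "k \<ge> 2" and "\<epsilon> > 0"
  shows "(\<lambda>n. measure_pmf.prob (random_graph_process n)
            {Gs. resilient (1 / 2 - \<epsilon>) k (k_connected k) (Gs ! hitting_time k Gs)})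
         \<longlonglongrightarrow> 1"
proof (rule tendsto_sandwich)
  let ?R = "\<lambda>\<epsilon>. {Gs :: nat ugraph list. resilient (1 / 2 - \<epsilon>) k (k_connected k) (Gs ! hitting_time k Gs)}"
  \<comment> \<open>The estimates assume \<open>\<epsilon> \<le> 1 / 2\<close>. A larger
    \<open>\<epsilon>\<close> permits fewer subgraphs \<open>H\<close>, so its event contains the
    one for \<open>1 / 2\<close>.\<close>
  show "(\<lambda>n. measure_pmf.prob (random_graph_process n) (?R (min \<epsilon> (1 / 2)))) \<longlonglongrightarrow> 1"
    using assms by (intro resilient_prob_tendsto) auto
  show "eventually (\<lambda>n. measure_pmf.prob (random_graph_process n) (?R (min \<epsilon> (1 / 2))) \<le>
     measure_pmf.prob (random_graph_process n) (?R \<epsilon>)) at_top"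
    by (intro always_eventually allI measure_pmf.finite_measure_mono) (auto elim: resilient_antimono)
qed (auto intro: tendsto_const)

end
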